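(* Let $c$ be a real number and $\theta$ a negative real number. Then the asymptotic expansion of $\mathrm{E}(z;c,\theta)=\sum_{n\ge1}\mathrm{e}^{cn^\theta}(-z)^n$ at $z=-1$ is obtained by inserting the expansions of the polylogarithms $\mathrm{Li}_{-k\theta}$ at $1$ termwise into the identity $$\mathrm{E}(z;c,\theta)=\sum_{k\ge0}\frac{c^k}{k!}\mathrm{Li}_{-k\theta}(-z),\qquad |z|<1.$$ That is, for every integer $N\ge0$, $$\mathrm{E}(z;c,\theta)=\sum_{k\ge0}\frac{c^k}{k!}S_{-k\theta,N}(w)+\mathrm{o}(w^N),\qquad w=-\log(-z),$$ as $z\to-1$ in $|z|<1$, where $S_{\alpha,N}(w)$ is the truncation of the expansion of $\mathrm{Li}_\alpha(-z)$ in $w$ obtained by keeping exactly the terms in which the exponent of $w$ is at most $N$ (terms with a factor $\log w$ included).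
   Context: $\mathrm{Li}_\alpha(x)=\sum_{n\ge1}x^n/n^\alpha$ for $|x|<1$. With $w=-\log x$ (principal branch), the known expansions of $\mathrm{Li}_\alpha(x)$ as $x\to1$ are: if $\alpha\notin\{1,2,3,\dots\}$, $$\mathrm{Li}_\alpha(x)=\Gamma(1-\alpha)w^{\alpha-1}+\sum_{j\ge0}\frac{(-1)^j}{j!}\zeta(\alpha-j)w^j;$$ if $\alpha\ge1$ is an integer, $$\mathrm{Li}_\alpha(x)=\frac{(-1)^\alpha}{(\alpha-1)!}w^{\alpha-1}(\log w-H_{\alpha-1})+\sum_{j\ge0,\,j\ne\alpha-1}\frac{(-1)^j}{j!}\zeta(\alpha-j)w^j,$$ where $H_m=\sum_{i=1}^m1/i$ (so $H_0=0$) and $\zeta$ is the Riemann zeta function. *)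

theory Defs
  imports "HOL-Analysis.Analysis" "HOL-Library.Landau_Symbols"
begin

text \<open>
  The Riemann zeta function, as the analytic continuation of its Dirichlet series to the
  plane without the pole 1. The value at the pole is irrelevant; it is fixed to 0 only so that
  the description determines a unique function.
\<close>

definition zeta :: "complex \<Rightarrow> complex" where
  "zeta = (THE f. f holomorphic_on (- {1}) \<and>
                  (\<forall>s. Re s > 1 \<longrightarrow> f s = (\<Sum>n. 1 / of_nat (Suc n) powr s)) \<and>
                  f 1 = 0)"

text \<open>The series below start at \<open>n = 1\<close>, hence the index \<open>Suc n\<close>. They are meant for
  arguments in the open unit disc.\<close>

definition polylog :: "real \<Rightarrow> complex \<Rightarrow> complex" where
  "polylog \<alpha> x = (\<Sum>n. x ^ Suc n / of_real (real (Suc n) powr \<alpha>))"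

definition E :: "complex \<Rightarrow> real \<Rightarrow> real \<Rightarrow> complex" where
  "E z c \<theta> = (\<Sum>n. of_real (exp (c * real (Suc n) powr \<theta>)) * (- z) ^ Suc n)"

text \<open>
  The expansion of \<open>polylog \<alpha> x\<close> at \<open>x = 1\<close> in \<open>w = - Ln x\<close> consists of one singular term, of
  exponent \<open>\<alpha> - 1\<close> (with a factor \<open>Ln w\<close> if \<open>\<alpha>\<close> is a positive integer), and of the
  terms of exponents \<open>j = 0, 1, 2, \<dots>\<close>, where \<open>j = \<alpha> - 1\<close> is omitted: this only concerns
  positive integers \<open>\<alpha>\<close>, and there \<open>zeta (\<alpha> - j)\<close> would be evaluated at the pole.
\<close>

definition polylog_singular_term :: "real \<Rightarrow> complex \<Rightarrow> complex" where
  "polylog_singular_term \<alpha> w =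
     (if \<exists>m::nat. m \<ge> 1 \<and> \<alpha> = real m
      then (let m = nat \<lfloor>\<alpha>\<rfloor>
            in (-1) ^ m / fact (m - 1) * w ^ (m - 1) * (Ln w - harm (m - 1)))
      else Gamma (of_real (1 - \<alpha>)) * w powr of_real (\<alpha> - 1))"

definition polylog_regular_term :: "real \<Rightarrow> nat \<Rightarrow> complex \<Rightarrow> complex" where
  "polylog_regular_term \<alpha> j w =
     (if real j = \<alpha> - 1 then 0
      else (-1) ^ j / fact j * zeta (of_real (\<alpha> - real j)) * w ^ j)"

text \<open>The truncation of the expansion to the terms of exponent at most \<open>N\<close>.\<close>

definition polylog_trunc :: "real \<Rightarrow> nat \<Rightarrow> complex \<Rightarrow> complex" where
  "polylog_trunc \<alpha> N w =
     (if \<alpha> - 1 \<le> real N then polylog_singular_term \<alpha> w else 0) +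
     (\<Sum>j\<le>N. polylog_regular_term \<alpha> j w)"

end

theory Submission
  imports Defs "HOL-Complex_Analysis.Complex_Analysis" "HOL-Real_Asymp.Real_Asymp"
begin

text \<open>
  Write \<open>x = exp (- w)\<close> with \<open>Re w > 0\<close>, and \<open>L\<^sub>s(w) = \<Sum>\<^bsub>n\<ge>1\<^esub> n\<^bsup>- s\<^esup> exp (- n w)\<close> for the polylogarithm of
  complex order \<open>s\<close> at \<open>x\<close> (\<open>exp_dirichlet\<close>). The theorem rests on two facts: the expansion of each single
  \<open>L\<^sub>\<alpha>\<close> at \<open>w = 0\<close>, and a bound for its remainder that is uniform in \<open>\<alpha>\<close> once \<open>\<alpha>\<close> is large.

  For the expansion, let \<open>A\<^sub>s(w) = L\<^sub>s(w) - \<Gamma>(1 - s) w\<^bsup>s - 1\<^esup>\<close> with \<open>s \<notin> {1, 2, 3, \<dots>}\<close> (\<open>regular_part\<close>).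
  Both terms satisfy \<open>f\<^sub>s' = - f\<^bsub>s-1\<^esub>\<close>, so the Taylor coefficients of \<open>A\<^sub>s\<close> at \<open>w = 1\<close> are the numbers
  \<open>(-1)\<^bsup>j\<^esup> A\<^bsub>s-j\<^esub>(1) / j!\<close>, explicit holomorphic functions of \<open>s\<close>. The heart of the proof is that they are
  \<open>O(\<rho>\<^bsup>- j\<^esup>)\<close> for every \<open>\<rho> < 2\<close>, locally uniformly in \<open>s\<close> (\<open>coeff_bounded_near_regular\<close>). For negative
  integer orders, \<open>A\<^sub>s\<close> is, up to sign, a derivative of \<open>A\<^sub>0(w) = 1 / (exp w - 1) - 1 / w\<close>, which is holomorphic for
  \<open>\<bar>Im w\<bar> < 2 \<pi>\<close>, and the Cauchy inequality gives the bound. For \<open>- 1 < Re s < 1\<close> the identity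
  \<open>\<Gamma>(s + 1) A\<^bsub>s-j\<^esub>(1) = \<integral>\<^sub>0\<^sup>\<infinity> t\<^bsup>s\<^esup> A\<^bsub>-j-1\<^esub>(t + 1) dt\<close> carries it over (\<open>regular_coeff_Mellin\<close>), and a shift of
  the order by an integer only shifts the coefficients.

  Hence the Taylor series at 1 extends \<open>A\<^sub>s\<close> to a disc that contains 0 (\<open>regular_extension\<close>), and its
  value at 0 is a holomorphic function of \<open>s\<close>. For \<open>Re s > 1\<close> the singular term vanishes at 0, and that
  value is \<open>L\<^sub>s(0)\<close>, the Dirichlet series. So the value at 0 is the analytic continuation of the
  series, that is \<open>zeta s\<close>; and since \<open>A\<^sub>s' = - A\<^bsub>s-1\<^esub>\<close>, the Taylor coefficients of \<open>A\<^sub>s\<close> at 0 are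
  \<open>(-1)\<^bsup>j\<^esup> zeta (s - j) / j!\<close>. This is the expansion for orders other than \<open>1, 2, 3, \<dots>\<close>. The orders
  \<open>m = 1, 2, 3, \<dots>\<close> follow from \<open>m = 0\<close> by integrating repeatedly: integration of \<open>1 / w\<close> creates the
  logarithm, and integration by parts the harmonic numbers (\<open>has_polylog_expansion_Suc\<close>).

  For \<open>\<alpha> \<ge> N + 3\<close> the remainder after the terms of exponent at most \<open>N\<close> is at most a constant times
  \<open>\<bar>w\<bar>\<^bsup>N + 1\<^esup>\<close>, with the same constant for all \<open>\<alpha>\<close> (\<open>polylog_remainder_large_order\<close>). In the series over
  \<open>k\<close> all but finitely many orders \<open>- k \<theta>\<close> are of this kind, and the weights \<open>c\<^bsup>k\<^esup> / k!\<close> are absolutely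
  summable; so the remainders may be added up (\<open>series_polylog_remainder_smallo\<close>).
\<close>

section \<open>Polylogarithms of complex order\<close>

text \<open>
  The polylogarithm of order \<open>s\<close> at \<open>exp (- w)\<close>, for a complex order. At \<open>w = 0\<close> this is the
  Dirichlet series of the zeta function.
\<close>

definition exp_dirichlet :: "complex \<Rightarrow> complex \<Rightarrow> complex" where
  "exp_dirichlet s w = (\<Sum>n. of_nat (Suc n) powr (- s) * exp (- of_nat (Suc n) * w))"

lemma norm_exp_dirichlet_term:
  "norm (of_nat (Suc n) powr (- s) * exp (- of_nat (Suc n) * w) :: complex) =
     real (Suc n) powr (- Re s) * exp (- real (Suc n) * Re w)"
proof -
  have "norm (of_real (real (Suc n)) powr (- s) :: complex) = real (Suc n) powr Re (- s)"
    by (subst norm_powr_real_powr) (auto simp del: of_nat_Suc)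
  moreover have "norm (exp (- of_nat (Suc n) * w)) = exp (- real (Suc n) * Re w)"
    by simp
  ultimately show ?thesis by (simp add: norm_mult)
qed

lemma summable_powr_exp:
  fixes p r :: real
  assumes "r > 0"
  shows "summable (\<lambda>n. real (Suc n) powr p * exp (- real (Suc n) * r))"
proof (rule summable_comparison_test_bigo)
  have "summable (\<lambda>n. inverse (real (Suc n) ^ 2))"
    using inverse_power_summable[of 2] by (subst summable_Suc_iff) simp
  then show "summable (\<lambda>n. norm (inverse (real (Suc n) ^ 2)))" by simp
  show "(\<lambda>n. real (Suc n) powr p * exp (- real (Suc n) * r)) \<in> O(\<lambda>n. inverse (real (Suc n) ^ 2))"
    using assms by real_asymp
qed

lemma summable_norm_exp_dirichlet:
  assumes "Re w > 0"
  shows "summable (\<lambda>n. norm (of_nat (Suc n) powr (- s) * exp (- of_nat (Suc n) * w) :: complex))"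
  unfolding norm_exp_dirichlet_term using summable_powr_exp[OF assms] .

lemma exp_dirichlet_sums:
  assumes "Re w > 0"
  shows "(\<lambda>n. of_nat (Suc n) powr (- s) * exp (- of_nat (Suc n) * w)) sums exp_dirichlet s w"
  unfolding exp_dirichlet_def
  using summable_norm_cancel[OF summable_norm_exp_dirichlet[OF assms]] by (rule summable_sums)

text \<open>
  Differentiation lowers the order by one. This is the relation behind everything below: it turns
  statements about all Taylor coefficients into statements about all orders \<open>s - j\<close>.
\<close>

lemma exp_dirichlet_has_derivative:
  assumes "Re w > 0"
  shows "(exp_dirichlet s has_field_derivative - exp_dirichlet (s - 1) w) (at w)"
proof -
  define f where "f = (\<lambda>n w. of_nat (Suc n) powr (- s) * exp (- of_nat (Suc n) * w) :: complex)"
  define f' where "f' = (\<lambda>n w. - (of_nat (Suc n) powr (- (s - 1)) * exp (- of_nat (Suc n) * w) :: complex))"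
  have "\<exists>g g'. \<forall>x\<in>{w. Re w > 0}. ((\<lambda>n. f n x) sums g x) \<and> ((\<lambda>n. f' n x) sums g' x) \<and> (g has_field_derivative g' x) (at x)"
  proof (rule series_and_derivative_comparison_local)
    show "open {w. Re w > 0}" by (rule open_halfspace_Re_gt)
    show "(f n has_field_derivative f' n x) (at x)" for n x
    proof -
      have "of_nat (Suc n) powr (- (s - 1)) = of_nat (Suc n) powr (- s) * (of_nat (Suc n) :: complex)"
        using powr_add[of "of_nat (Suc n) :: complex" "- s" 1]
        by (simp del: of_nat_Suc add: algebra_simps)
      then show ?thesis
        unfolding f_def f'_def by (auto intro!: derivative_eq_intros simp del: of_nat_Suc)
    qed
    fix x :: complex assume "x \<in> {w. Re w > 0}"
    then have x: "Re x > 0" by simp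
    show "\<exists>d h. 0 < d \<and> summable h \<and> (\<forall>\<^sub>F n in sequentially. \<forall>y\<in>ball x d \<inter> {w. 0 < Re w}. norm (f n y) \<le> h n)"
    proof (intro exI conjI always_eventually allI ballI)
      show "0 < Re x / 2" using x by simp
      show "summable (\<lambda>n. real (Suc n) powr (- Re s) * exp (- real (Suc n) * (Re x / 2)))"
        using x by (intro summable_powr_exp) simp
      fix n y assume "y \<in> ball x (Re x / 2) \<inter> {w. 0 < Re w}"
      then have "Re y \<ge> Re x / 2"
        using abs_Re_le_cmod[of "x - y"] by (simp add: dist_norm abs_le_iff)
      then have "real (Suc n) * (Re x / 2) \<le> real (Suc n) * Re y"
        by (intro mult_left_mono) simp_all
      then show "norm (f n y) \<le> real (Suc n) powr (- Re s) * exp (- real (Suc n) * (Re x / 2))"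
        unfolding f_def norm_exp_dirichlet_term by (intro mult_left_mono) simp_all
    qed
  qed
  then obtain g g' where g: "\<And>x. Re x > 0 \<Longrightarrow> (\<lambda>n. f n x) sums g x"
    "\<And>x. Re x > 0 \<Longrightarrow> (\<lambda>n. f' n x) sums g' x"
    "\<And>x. Re x > 0 \<Longrightarrow> (g has_field_derivative g' x) (at x)" by auto
  have gL: "g x = exp_dirichlet s x" if "Re x > 0" for x
    using sums_unique2[OF g(1)[OF that]] exp_dirichlet_sums[OF that, of s] by (simp add: f_def)
  have g'L: "g' w = - exp_dirichlet (s - 1) w"
    using sums_unique2[OF g(2)[OF assms]] sums_minus[OF exp_dirichlet_sums[OF assms, of "s - 1"]]
    unfolding f'_def by blast
  have "(g has_field_derivative - exp_dirichlet (s - 1) w) (at w)"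
    using g(3)[OF assms] g'L by simp
  then show ?thesis
    by (rule has_field_derivative_transform_within_open[OF _ open_halfspace_Re_gt[of 0]]) (use assms gL in auto)
qed

lemma Dirichlet_term_has_derivative:
  "((\<lambda>s. of_nat (Suc n) powr (- s) * c) has_field_derivative - of_real (ln (real (Suc n))) * (of_nat (Suc n) powr (- s) * c)) (at s)" for s c :: complex
proof -
  have "Ln (of_nat (Suc n)) = (of_real (ln (real (Suc n))) :: complex)"
    using Ln_of_real[of "real (Suc n)"] by simp
  moreover have "(of_nat (Suc n) :: complex) \<noteq> 0" by (simp del: of_nat_Suc)
  ultimately show ?thesis
    unfolding powr_def by (auto intro!: derivative_eq_intros simp del: of_nat_Suc)
qed

lemma exp_dirichlet_holomorphic_order:
  assumes "Re w > 0"
  shows "(\<lambda>s. exp_dirichlet s w) holomorphic_on UNIV"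
proof -
  define f where "f = (\<lambda>n s. of_nat (Suc n) powr (- s) * exp (- of_nat (Suc n) * w) :: complex)"
  define f' where "f' = (\<lambda>n s. - of_real (ln (real (Suc n))) * f n s)"
  have "\<exists>g g'. \<forall>x\<in>UNIV. ((\<lambda>n. f n x) sums g x) \<and> ((\<lambda>n. f' n x) sums g' x) \<and> (g has_field_derivative g' x) (at x)"
  proof (rule series_and_derivative_comparison_local)
    show "(f n has_field_derivative f' n x) (at x)" for n x
      unfolding f_def f'_def by (rule Dirichlet_term_has_derivative)
    fix x :: complex
    show "\<exists>d h. 0 < d \<and> summable h \<and> (\<forall>\<^sub>F n in sequentially. \<forall>y\<in>ball x d \<inter> UNIV. norm (f n y) \<le> h n)"
    proof (intro exI conjI always_eventually allI ballI)
      show "0 < (1::real)" by simp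
      show "summable (\<lambda>n. real (Suc n) powr (1 - Re x) * exp (- real (Suc n) * Re w))"
        using assms by (intro summable_powr_exp) simp
      fix n y assume "y \<in> ball x 1 \<inter> UNIV"
      then have "- Re y \<le> 1 - Re x"
        using abs_Re_le_cmod[of "x - y"] by (simp add: dist_norm)
      then have "real (Suc n) powr (- Re y) \<le> real (Suc n) powr (1 - Re x)"
        by (intro powr_mono) simp_all
      then show "norm (f n y) \<le> real (Suc n) powr (1 - Re x) * exp (- real (Suc n) * Re w)"
        unfolding f_def norm_exp_dirichlet_term by (intro mult_right_mono) simp_all
    qed
  qed simp
  then obtain g g' where g: "\<And>x. (\<lambda>n. f n x) sums g x" "\<And>x. (g has_field_derivative g' x) (at x)" by auto
  have "g x = exp_dirichlet x w" for x
    using sums_unique2[OF g(1)] exp_dirichlet_sums[OF assms, of x] by (simp add: f_def)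
  then have "g = (\<lambda>s. exp_dirichlet s w)" by auto
  with g(2) show ?thesis by (auto simp: holomorphic_on_open)
qed

lemma summable_Dirichlet:
  fixes p :: real
  assumes "p > 1"
  shows "summable (\<lambda>n. real (Suc n) powr (- p))"
  using assms summable_real_powr_iff[of "- p"] by (subst summable_Suc_iff) simp

lemma Dirichlet_holomorphic:
  "(\<lambda>s. exp_dirichlet s 0) holomorphic_on {s. Re s > 1}"
proof -
  define f where "f = (\<lambda>n s. of_nat (Suc n) powr (- s) * 1 :: complex)"
  define f' where "f' = (\<lambda>n s. - of_real (ln (real (Suc n))) * f n s)"
  have "\<exists>g g'. \<forall>x\<in>{s. Re s > 1}. ((\<lambda>n. f n x) sums g x) \<and> ((\<lambda>n. f' n x) sums g' x) \<and> (g has_field_derivative g' x) (at x)"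
  proof (rule series_and_derivative_comparison_local)
    show "open {s. Re s > 1}" by (rule open_halfspace_Re_gt)
    show "(f n has_field_derivative f' n x) (at x)" for n x
      unfolding f_def f'_def by (rule Dirichlet_term_has_derivative)
    fix x :: complex assume "x \<in> {s. Re s > 1}"
    then have x: "Re x > 1" by simp
    show "\<exists>d h. 0 < d \<and> summable h \<and> (\<forall>\<^sub>F n in sequentially. \<forall>y\<in>ball x d \<inter> {s. Re s > 1}. norm (f n y) \<le> h n)"
    proof (intro exI conjI always_eventually allI ballI)
      show "0 < (Re x - 1) / 2" using x by simp
      show "summable (\<lambda>n. real (Suc n) powr (- ((Re x + 1) / 2)))"
        using x by (intro summable_Dirichlet) simp
      fix n y assume "y \<in> ball x ((Re x - 1) / 2) \<inter> {s. Re s > 1}"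
      then have "- Re y \<le> - ((Re x + 1) / 2)"
        using abs_Re_le_cmod[of "x - y"] by (simp add: dist_norm abs_le_iff field_simps)
      then have "real (Suc n) powr (- Re y) \<le> real (Suc n) powr (- ((Re x + 1) / 2))"
        by (intro powr_mono) simp_all
      then show "norm (f n y) \<le> real (Suc n) powr (- ((Re x + 1) / 2))"
        using norm_exp_dirichlet_term[of n y 0] by (simp add: f_def)
    qed
  qed
  then obtain g g' where g: "\<And>x. Re x > 1 \<Longrightarrow> (\<lambda>n. f n x) sums g x"
     "\<And>x. Re x > 1 \<Longrightarrow> (g has_field_derivative g' x) (at x)" by auto
  have "exp_dirichlet x 0 = g x" if "Re x > 1" for x
    using sums_unique[OF g(1)[OF that]] by (simp add: f_def exp_dirichlet_def)
  moreover have "g holomorphic_on {s. Re s > 1}"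
    using g(2) by (auto simp: holomorphic_on_open open_halfspace_Re_gt)
  ultimately show ?thesis by (auto intro: holomorphic_transform)
qed

text \<open>
  The series converges uniformly on the closed half-plane, so the value at the boundary point 0
  is a limit from inside.
\<close>

lemma exp_dirichlet_tendsto_0:
  assumes "Re s > 1"
  shows "(exp_dirichlet s \<longlongrightarrow> exp_dirichlet s 0) (at 0 within {w. Re w > 0})"
proof -
  have "uniform_limit {w. Re w \<ge> 0} (\<lambda>n w. \<Sum>i<n. of_nat (Suc i) powr (- s) * exp (- of_nat (Suc i) * w))
          (exp_dirichlet s) sequentially"
    unfolding exp_dirichlet_def[abs_def]
  proof (rule Weierstrass_m_test)
    show "summable (\<lambda>n. real (Suc n) powr (- Re s))"
      using assms by (rule summable_Dirichlet)
    fix n w assume "w \<in> {w. Re w \<ge> 0}"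
    then show "norm (of_nat (Suc n) powr (- s) * exp (- of_nat (Suc n) * w)) \<le> real (Suc n) powr (- Re s)"
      unfolding norm_exp_dirichlet_term by (intro mult_left_le) (simp_all add: mult_nonpos_nonneg)
  qed
  then have "continuous_on {w. Re w \<ge> 0} (exp_dirichlet s)"
    by (rule uniform_limit_theorem[rotated]) (auto intro!: continuous_intros always_eventually)
  then have "(exp_dirichlet s \<longlongrightarrow> exp_dirichlet s 0) (at 0 within {w. Re w \<ge> 0})"
    by (simp add: continuous_on_def)
  then show ?thesis by (rule tendsto_within_subset) auto
qed

section \<open>The regular part of a polylogarithm\<close>

text \<open>
  The complement of \<open>{1, 2, 3, \<dots>}\<close>, written through the poles of the Gamma factor of the
  singular term.
\<close>

definition regular_orders :: "complex set" where
  "regular_orders = {s. 1 - s \<notin> \<int>\<^sub>\<le>\<^sub>0}"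

definition regular_part :: "complex \<Rightarrow> complex \<Rightarrow> complex" where
  "regular_part s w = exp_dirichlet s w - Gamma (1 - s) * w powr (s - 1)"

lemma open_regular_orders: "open regular_orders"
proof -
  have "closed ((\<lambda>s. 1 - s) -` (\<int>\<^sub>\<le>\<^sub>0 :: complex set))"
    by (intro continuous_closed_vimage closed_nonpos_Ints) auto
  moreover have "regular_orders = - ((\<lambda>s. 1 - s) -` \<int>\<^sub>\<le>\<^sub>0)"
    by (auto simp: regular_orders_def)
  ultimately show ?thesis by (simp add: closed_def)
qed

lemma regular_orders_diff_1: "s \<in> regular_orders \<Longrightarrow> s - 1 \<in> regular_orders"
proof -
  have "1 - s \<in> \<int>\<^sub>\<le>\<^sub>0" if "1 - (s - 1) \<in> \<int>\<^sub>\<le>\<^sub>0"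
  proof -
    from that obtain n where "1 - (s - 1) = - of_nat n" by (auto elim!: nonpos_Ints_cases')
    then have "1 - s = - of_nat (Suc n)" by (simp add: algebra_simps)
    then show ?thesis using minus_of_nat_in_nonpos_Ints[of "Suc n"] by metis
  qed
  then show "s \<in> regular_orders \<Longrightarrow> s - 1 \<in> regular_orders" by (auto simp: regular_orders_def)
qed

lemma regular_orders_diff: "s \<in> regular_orders \<Longrightarrow> s - of_nat n \<in> regular_orders"
proof (induction n)
  case (Suc n)
  then show ?case using regular_orders_diff_1[of "s - of_nat n"] by (simp add: algebra_simps)
qed simp

lemma Re_less_1_regular: "Re s < 1 \<Longrightarrow> s \<in> regular_orders"
proof (rule ccontr)
  assume s: "Re s < 1" "s \<notin> regular_orders"
  then obtain n where "1 - s = - of_nat n"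
    by (auto simp: regular_orders_def elim!: nonpos_Ints_cases')
  then have "Re (1 - s) = - real n" by simp
  with s show False by simp
qed

text \<open>
  Because \<open>\<Gamma>(2 - s) = (1 - s) \<Gamma>(1 - s)\<close>, the singular term obeys the same differentiation rule
  as the series, and hence so does the difference.
\<close>

lemma regular_part_has_derivative:
  assumes s: "s \<in> regular_orders" and w: "Re w > 0"
  shows "(regular_part s has_field_derivative - regular_part (s - 1) w) (at w)"
proof -
  have w0: "w \<notin> \<real>\<^sub>\<le>\<^sub>0" using w by (auto simp: complex_nonpos_Reals_iff)
  have "Gamma ((1 - s) + 1) = (1 - s) * Gamma (1 - s)"
    using s by (intro Gamma_plus1) (simp add: regular_orders_def)
  then have G: "Gamma (1 - (s - 1)) = (1 - s) * Gamma (1 - s)" by (simp add: algebra_simps)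
  have "(regular_part s has_field_derivative
      - exp_dirichlet (s - 1) w - Gamma (1 - s) * ((s - 1) * w powr (s - 1 - 1))) (at w)"
    unfolding regular_part_def[abs_def] using w0
    by (auto intro!: derivative_eq_intros exp_dirichlet_has_derivative[OF w])
  also have "- exp_dirichlet (s - 1) w - Gamma (1 - s) * ((s - 1) * w powr (s - 1 - 1)) = - regular_part (s - 1) w"
    unfolding regular_part_def G by (simp add: algebra_simps)
  finally show ?thesis .
qed

lemma higher_deriv_regular_part:
  assumes s: "s \<in> regular_orders" and w: "Re w > 0"
  shows "(deriv ^^ n) (regular_part s) w = (-1) ^ n * regular_part (s - of_nat n) w"
  using w
proof (induction n arbitrary: w)
  case (Suc n)
  have "((\<lambda>w. (-1) ^ n * regular_part (s - of_nat n) w) has_field_derivative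
      (-1) ^ n * - regular_part (s - of_nat n - 1) w) (at w)"
    by (intro DERIV_cmult regular_part_has_derivative regular_orders_diff s Suc.prems)
  then have "((deriv ^^ n) (regular_part s) has_field_derivative
      (-1) ^ n * - regular_part (s - of_nat n - 1) w) (at w)"
    by (rule has_field_derivative_transform_within_open[OF _ open_halfspace_Re_gt[of 0]])
       (use Suc in auto)
  from DERIV_imp_deriv[OF this] show ?case by (simp add: algebra_simps)
qed simp

lemma regular_part_holomorphic:
  assumes "s \<in> regular_orders"
  shows "regular_part s holomorphic_on {w. Re w > 0}"
  using regular_part_has_derivative[OF assms] by (auto simp: holomorphic_on_open open_halfspace_Re_gt)

lemma exp_dirichlet_0:
  assumes "Re w > 0"
  shows "exp_dirichlet 0 w = 1 / (exp w - 1)"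
proof -
  have n: "norm (exp (- w)) < 1" using assms by simp
  have "(\<lambda>n. exp (- w) ^ n * exp (- w)) sums (1 / (1 - exp (- w)) * exp (- w))"
    by (intro sums_mult2 geometric_sums n)
  moreover have "of_nat (Suc n) powr (- 0) * exp (- of_nat (Suc n) * w) = exp (- w) ^ n * exp (- w)" for n
  proof -
    have "(of_nat (Suc n) :: complex) \<noteq> 0" by (simp del: of_nat_Suc)
    then show ?thesis
      using exp_of_nat_mult[of "Suc n" "- w"] by (simp del: of_nat_Suc)
  qed
  ultimately have "exp_dirichlet 0 w = 1 / (1 - exp (- w)) * exp (- w)"
    unfolding exp_dirichlet_def by (simp add: sums_iff)
  also have "\<dots> = 1 / (exp w - 1)"
    by (simp add: exp_minus divide_simps)
  finally show ?thesis .
qed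

text \<open>
  For order 0 the series is geometric, and its regular part \<open>1 / (exp w - 1) - 1 / w\<close> has a
  removable singularity at 0. The nearest genuine singularities are \<open>\<plusminus> 2 \<pi> \<i>\<close>.
\<close>

lemma regular_part_0_extension:
  obtains g where "g holomorphic_on {w. \<bar>Im w\<bar> < 2 * pi}"
    and "\<And>w. Re w > 0 \<Longrightarrow> g w = regular_part 0 w"
proof -
  define S where "S = {w::complex. \<bar>Im w\<bar> < 2 * pi}"
  have S: "open S"
    unfolding S_def by (intro open_Collect_less continuous_intros)
  \<comment> \<open>\<open>\<phi> w = (exp w - 1) / w\<close> and \<open>\<psi> = 1 / \<phi>\<close>, so that \<open>(\<psi> w - 1) / w\<close> is the wanted extension.\<close>
  define \<phi> where "\<phi> = (\<lambda>w::complex. if w = 0 then deriv exp 0 else (exp w - exp 0) / (w - 0))"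
  have \<phi>_holo: "\<phi> holomorphic_on S"
    unfolding \<phi>_def by (intro pole_lemma_open S holomorphic_intros)
  have \<phi>_nz: "\<phi> w \<noteq> 0" if "w \<in> S" for w
  proof (cases "w = 0")
    case True
    have "deriv exp (0::complex) = exp 0" by (rule DERIV_imp_deriv, rule DERIV_exp)
    then show ?thesis using True by (simp add: \<phi>_def)
  next
    case False
    have "exp w \<noteq> 1"
    proof
      assume "exp w = 1"
      then obtain n :: int where n: "Re w = 0" "Im w = of_int (2 * n) * pi" by (auto simp: exp_eq_1)
      then have "\<bar>real_of_int (2 * n)\<bar> * pi < 2 * pi" using that by (simp add: S_def abs_mult)
      then have "\<bar>real_of_int n\<bar> < 1" by simp
      then have "n = 0" by linarith
      with n False show False by (simp add: complex_eq_iff)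
    qed
    then show ?thesis using False by (simp add: \<phi>_def)
  qed
  define \<psi> where "\<psi> = (\<lambda>w. 1 / \<phi> w)"
  have \<psi>: "\<psi> holomorphic_on S"
    unfolding \<psi>_def using \<phi>_nz by (intro holomorphic_intros \<phi>_holo) auto
  define g where "g = (\<lambda>w. if w = 0 then deriv \<psi> 0 else (\<psi> w - \<psi> 0) / (w - 0))"
  have "g holomorphic_on S" unfolding g_def by (intro pole_lemma_open S \<psi>)
  moreover have "g w = regular_part 0 w" if "Re w > 0" for w
  proof -
    have w: "w \<noteq> 0" using that by auto
    have "norm (exp w) \<noteq> 1" using that by simp
    then have e: "exp w - 1 \<noteq> 0" by (metis norm_one eq_iff_diff_eq_0)
    have "deriv exp (0::complex) = exp 0" by (rule DERIV_imp_deriv, rule DERIV_exp)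
    then have "\<psi> 0 = 1" by (simp add: \<psi>_def \<phi>_def)
    then have "g w = 1 / (exp w - 1) - 1 / w"
      using w e by (simp add: g_def \<psi>_def \<phi>_def field_simps)
    also have "\<dots> = regular_part 0 w"
      using w by (simp add: regular_part_def exp_dirichlet_0[OF that] powr_minus divide_inverse)
    finally show ?thesis .
  qed
  ultimately show ?thesis using that by (simp add: S_def)
qed

lemma regular_part_minus_1_formula:
  assumes w: "Re w > 0"
  shows "regular_part (- 1) w = exp w / (exp w - 1) ^ 2 - 1 / w ^ 2"
proof -
  have w0: "w \<noteq> 0" using w by auto
  have "norm (exp w) \<noteq> 1" using w by simp
  then have e: "exp w - 1 \<noteq> 0" by (metis norm_one eq_iff_diff_eq_0)
  have "((\<lambda>w. 1 / (exp w - 1) - 1 / w) has_field_derivative - (exp w / (exp w - 1) ^ 2 - 1 / w ^ 2)) (at w)"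
    using w0 e by (auto intro!: derivative_eq_intros simp: power2_eq_square)
  moreover have "1 / (exp w - 1) - 1 / w = regular_part 0 w" if "Re w > 0" for w
  proof -
    have "w \<noteq> 0" using that by auto
    then show ?thesis by (simp add: regular_part_def exp_dirichlet_0[OF that] powr_minus divide_inverse)
  qed
  ultimately have "(regular_part 0 has_field_derivative - (exp w / (exp w - 1) ^ 2 - 1 / w ^ 2)) (at w)"
    by (elim has_field_derivative_transform_within_open[OF _ open_halfspace_Re_gt[of 0]]) (use w in auto)
  moreover have "(regular_part 0 has_field_derivative - regular_part (0 - 1) w) (at w)"
    by (intro regular_part_has_derivative Re_less_1_regular w) simp
  ultimately have "- (exp w / (exp w - 1) ^ 2 - 1 / w ^ 2) = - regular_part (0 - 1) w" by (rule DERIV_unique)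
  then show ?thesis by (simp add: algebra_simps)
qed

text \<open>
  Far to the right the exponential part is negligible and the bound is the decay of \<open>1 / w\<^sup>2\<close>.
  This decay makes the bound on the Taylor coefficients integrable.
\<close>

lemma norm_regular_part_minus_1_le:
  assumes w: "Re w \<ge> 1"
  shows "norm (regular_part (- 1) w) \<le> 9 / Re w ^ 2"
proof -
  define x where "x = Re w"
  have x: "x \<ge> 1" using w by (simp add: x_def)
  have ex: "exp x \<ge> 1 + x + x ^ 2 / 2" using exp_lower_Taylor_quadratic[of x] x by simp
  have "norm (exp w - 1) \<ge> exp x - 1"
    using norm_triangle_ineq2[of "exp w" 1] by (simp add: x_def)
  moreover have "exp x - 1 \<ge> exp x / 2" using ex x zero_le_power2[of x] by linarith
  ultimately have n: "norm (exp w - 1) \<ge> exp x / 2" by linarith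
  have "norm (exp w / (exp w - 1) ^ 2) \<le> exp x / (exp x / 2) ^ 2"
    using n by (auto simp: norm_divide norm_power x_def intro!: divide_left_mono power_mono mult_pos_pos zero_less_power)
  also have "\<dots> = 4 / exp x" by (simp add: power2_eq_square field_simps)
  also have "\<dots> \<le> 4 / (x ^ 2 / 2)" using ex x by (intro divide_left_mono mult_pos_pos) auto
  finally have 1: "norm (exp w / (exp w - 1) ^ 2) \<le> 8 / x ^ 2" by simp
  have 2: "norm (1 / w ^ 2) \<le> 1 / x ^ 2"
    using x complex_Re_le_cmod[of w]
    by (auto simp: norm_divide norm_power x_def intro!: divide_left_mono power_mono mult_pos_pos zero_less_power)
  have "norm (regular_part (- 1) w) \<le> norm (exp w / (exp w - 1) ^ 2) + norm (1 / w ^ 2)"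
    using w by (subst regular_part_minus_1_formula) (auto intro: norm_triangle_ineq4)
  also have "\<dots> \<le> 8 / x ^ 2 + 1 / x ^ 2" using 1 2 by (rule add_mono)
  finally show ?thesis by (simp add: x_def)
qed

text \<open>
  The regular parts of negative integer order are the derivatives of the function
  \<open>1 / (exp w - 1) - 1 / w\<close>, up to sign. It is holomorphic on the strip \<open>\<bar>Im w\<bar> < 2 \<pi>\<close>, so
  the Cauchy inequality applies on discs of radius 2 around points of the real axis, and its first
  derivative is \<open>O(1 / u\<^sup>2)\<close> on the disc around \<open>u\<close>.
\<close>

lemma regular_part_neg_nat_bound:
  obtains C where "C \<ge> 0" and "\<And>j u. u \<ge> 1 \<Longrightarrow>
    norm (regular_part (- of_nat (Suc j)) (of_real u)) \<le> C * fact j / 2 ^ j / u ^ 2"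
proof -
  obtain g where g: "g holomorphic_on {w. \<bar>Im w\<bar> < 2 * pi}"
    "\<And>w. Re w > 0 \<Longrightarrow> g w = regular_part 0 w" by (rule regular_part_0_extension) auto
  define S where "S = {w::complex. \<bar>Im w\<bar> < 2 * pi}"
  have S: "open S" unfolding S_def by (intro open_Collect_less continuous_intros)
  define h where "h = deriv g"
  have h: "h holomorphic_on S" unfolding h_def using g(1) S by (intro holomorphic_deriv) (auto simp: S_def)
  have hr: "h w = - regular_part (- 1) w" if "Re w > 0" for w
  proof -
    have "(regular_part 0 has_field_derivative - regular_part (0 - 1) w) (at w)"
      by (intro regular_part_has_derivative Re_less_1_regular that) simp
    then have "(g has_field_derivative - regular_part (0 - 1) w) (at w)"
      by (rule has_field_derivative_transform_within_open[OF _ open_halfspace_Re_gt[of 0]]) (use that g(2) in auto)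
    then show ?thesis by (simp add: h_def DERIV_imp_deriv)
  qed
  have cb: "cball (of_real u) 2 \<subseteq> S" for u :: real
  proof
    fix v :: complex assume "v \<in> cball (of_real u) 2"
    then have "\<bar>Im v\<bar> \<le> 2" using abs_Im_le_cmod[of "of_real u - v"] by (simp add: dist_norm)
    then show "v \<in> S" using pi_gt3 by (simp add: S_def)
  qed
  \<comment> \<open>The box covers the discs of radius 2 around all \<open>u \<in> [1, 4]\<close>; further right the decay bound applies.\<close>
  define K where "K = cbox (Complex (- 1) (- 2)) (Complex 6 2)"
  have "K \<subseteq> S" using pi_gt3 by (auto simp: K_def S_def in_cbox_complex_iff)
  then have "continuous_on K h" using h holomorphic_on_imp_continuous_on holomorphic_on_subset by blast
  then have "bounded (h ` K)" by (intro compact_imp_bounded compact_continuous_image) (auto simp: K_def)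
  then obtain B where B: "B > 0" "\<And>v. v \<in> K \<Longrightarrow> norm (h v) \<le> B" by (auto simp: bounded_pos)
  define C where "C = max (16 * B) 36"
  have hb: "norm (h v) \<le> C / u ^ 2" if u: "u \<ge> 1" and v: "norm (of_real u - v) = 2" for u v
  proof -
    have im: "\<bar>Im v\<bar> \<le> 2" and re: "\<bar>u - Re v\<bar> \<le> 2"
      using abs_Im_le_cmod[of "of_real u - v"] abs_Re_le_cmod[of "of_real u - v"] v by simp_all
    show ?thesis
    proof (cases "u \<le> 4")
      case True
      then have "v \<in> K" using im re u by (auto simp: K_def in_cbox_complex_iff)
      then have "norm (h v) \<le> B" by (rule B)
      also have "\<dots> \<le> C / u ^ 2"
      proof -
        have "B * u ^ 2 \<le> B * 4 ^ 2" using True u B(1) by (intro mult_left_mono power_mono) auto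
        also have "\<dots> \<le> C" by (simp add: C_def)
        finally show ?thesis using u by (simp add: field_simps)
      qed
      finally show ?thesis .
    next
      case False
      then have re': "Re v \<ge> u / 2" "Re v \<ge> 1" using re by linarith+
      then have "norm (h v) \<le> 9 / Re v ^ 2"
        using hr[of v] norm_regular_part_minus_1_le[of v] by simp
      also have "\<dots> \<le> 9 / (u / 2) ^ 2"
        using re' u by (intro divide_left_mono power_mono mult_pos_pos zero_less_power) auto
      also have "\<dots> \<le> C / u ^ 2"
        using u by (simp add: C_def power2_eq_square divide_simps)
      finally show ?thesis .
    qed
  qed
  show ?thesis
  proof (rule that[of C])
    show "C \<ge> 0" by (simp add: C_def)
    fix j :: nat and u :: real assume u: "u \<ge> 1"
    have "(deriv ^^ Suc j) (regular_part 0) (of_real u) = (deriv ^^ Suc j) g (of_real u)"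
    proof (rule higher_deriv_transform_within_open[of _ "{w. Re w > 0} \<inter> S"])
      show "regular_part 0 holomorphic_on {w. Re w > 0} \<inter> S"
        by (rule holomorphic_on_subset[OF regular_part_holomorphic]) (auto intro: Re_less_1_regular)
      show "g holomorphic_on {w. Re w > 0} \<inter> S" using g(1) by (rule holomorphic_on_subset) (auto simp: S_def)
    qed (use u g(2) S in \<open>auto simp: open_halfspace_Re_gt S_def intro!: open_Int\<close>)
    then have "(-1) ^ Suc j * regular_part (- of_nat (Suc j)) (of_real u) = (deriv ^^ j) h (of_real u)"
      using higher_deriv_regular_part[of 0 "of_real u" "Suc j"] u
      by (simp add: h_def funpow_Suc_right Re_less_1_regular del: funpow.simps)
    then have "norm (regular_part (- of_nat (Suc j)) (of_real u)) = norm ((deriv ^^ j) h (of_real u))"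
      by (metis norm_mult norm_minus_cancel norm_one norm_power power_one mult_1)
    also have "\<dots> \<le> fact j * (C / u ^ 2) / 2 ^ j"
    proof (rule Cauchy_inequality)
      show "h holomorphic_on ball (of_real u) 2"
        using h cb[of u] ball_subset_cball holomorphic_on_subset by blast
      show "continuous_on (cball (of_real u) 2) h"
        using h cb[of u] holomorphic_on_imp_continuous_on holomorphic_on_subset by blast
    qed (use hb[OF u] in auto)
    finally show "norm (regular_part (- of_nat (Suc j)) (of_real u)) \<le> C * fact j / 2 ^ j / u ^ 2"
      by (simp add: mult_ac)
  qed
qed

section \<open>Gamma and Beta integrals over the half-line\<close>

lemma Gamma_kernel_unit:
  fixes z :: complex
  assumes z: "Re z > 0"
  defines "f \<equiv> \<lambda>t::real. indicator {0<..} t *\<^sub>R (of_real t powr (z - 1) * exp (- of_real t))"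
  shows "integrable lborel f" and "integral\<^sup>L lborel f = Gamma z"
proof -
  have eq: "f = (\<lambda>t. indicator {0<..} t *\<^sub>R (of_real t powr (z - 1) / of_real (exp t)))"
    by (auto simp: f_def exp_minus field_simps exp_of_real)
  have meas: "f \<in> borel_measurable lborel"
    unfolding f_def by (auto intro!: borel_measurable_continuous_on_indicator continuous_intros)
  have int: "integrable lebesgue f"
    using absolutely_integrable_Gamma_integral'[OF z] by (simp add: eq set_integrable_def)
  show i: "integrable lborel f"
    using int meas integrable_completion by blast
  have "integral\<^sup>L lebesgue f = integral {0<..} (\<lambda>t. of_real t powr (z - 1) / of_real (exp t))"
    using set_lebesgue_integral_eq_integral(2)[OF absolutely_integrable_Gamma_integral'[OF z]]
    by (simp add: eq set_lebesgue_integral_def)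
  also have "\<dots> = Gamma z"
    using Gamma_integral_complex'[OF z] by (rule integral_unique)
  finally show "integral\<^sup>L lborel f = Gamma z"
    using integral_completion[OF meas] by simp
qed

lemma Gamma_kernel:
  fixes z :: complex and a :: real
  assumes z: "Re z > 0" and a: "a > 0"
  defines "f \<equiv> \<lambda>t::real. indicator {0<..} t *\<^sub>R (of_real t powr (z - 1) * exp (- of_real (a * t)))"
  shows "integrable lborel f" and "integral\<^sup>L lborel f = Gamma z * of_real a powr (- z)"
proof -
  define g where "g = (\<lambda>t::real. indicator {0<..} t *\<^sub>R (of_real t powr (z - 1) * exp (- of_real t :: complex)))"
  have g: "integrable lborel g" "integral\<^sup>L lborel g = Gamma z"
    using Gamma_kernel_unit[OF z] by (simp_all add: g_def)
  \<comment> \<open>Both integrals reduce to the case \<open>a = 1\<close> by scaling.\<close>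
  have fg: "f t = of_real a powr (1 - z) * g (0 + a * t)" for t
  proof (cases "t > 0")
    case True
    have "(of_real (a * t) :: complex) powr (z - 1) = of_real a powr (z - 1) * of_real t powr (z - 1)"
      using a True by (simp add: powr_times_real)
    moreover have "(of_real a :: complex) powr (1 - z) * of_real a powr (z - 1) = 1"
      using a by (simp flip: powr_add)
    ultimately show ?thesis using True a by (simp add: f_def g_def mult_ac)
  next
    case False
    then show ?thesis using a by (auto simp: f_def g_def zero_less_mult_iff)
  qed
  have ga: "integrable lborel (\<lambda>t. g (0 + a * t))"
    using lborel_integrable_real_affine[OF g(1), of a 0] a by simp
  show "integrable lborel f"
    unfolding fg[abs_def] by (intro integrable_mult_right ga)
  have "integral\<^sup>L lborel f = of_real a powr (1 - z) * integral\<^sup>L lborel (\<lambda>t. g (0 + a * t))"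
    unfolding fg[abs_def] using ga by simp
  also have "integral\<^sup>L lborel (\<lambda>t. g (0 + a * t)) = Gamma z / of_real a"
    using lborel_integral_real_affine[of a g 0] a g(2) by (auto simp: scaleR_conv_of_real field_simps)
  also have "of_real a powr (1 - z) * (Gamma z / of_real a) = Gamma z * of_real a powr (- z)"
    using a by (simp add: powr_diff powr_minus divide_simps)
  finally show "integral\<^sup>L lborel f = Gamma z * of_real a powr (- z)" .
qed

text \<open>
  The real case gives the integrals of absolute values that justify the exchanges of sums and integrals.
\<close>

lemma Gamma_kernel_norm:
  fixes p a :: real
  assumes p: "p > 0" and a: "a > 0"
  defines "f \<equiv> \<lambda>t::real. indicator {0<..} t * (t powr (p - 1) * exp (- (a * t)))"
  shows "integrable lborel f" and "integral\<^sup>L lborel f = Gamma p * a powr (- p)"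
proof -
  define F where "F = (\<lambda>t::real. indicator {0<..} t *\<^sub>R (of_real t powr (of_real p - 1) * exp (- of_real (a * t)) :: complex))"
  have F: "integrable lborel F" "integral\<^sup>L lborel F = Gamma (of_real p) * of_real a powr (- of_real p)"
    using Gamma_kernel[of "of_real p" a] p a by (simp_all add: F_def)
  have fF: "f t = Re (F t)" for t
  proof (cases "t > 0")
    case True
    have "(of_real t :: complex) powr (of_real p - 1) = of_real (t powr (p - 1))"
      using True powr_of_real[of t "p - 1"] by simp
    then show ?thesis using True by (simp add: f_def F_def exp_of_real flip: of_real_minus of_real_mult)
  qed (simp add: f_def F_def)
  show "integrable lborel f" unfolding fF[abs_def] by (intro integrable_Re F)
  have "integral\<^sup>L lborel f = Re (integral\<^sup>L lborel F)"
    unfolding fF[abs_def] using F(1) by simp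
  also have "\<dots> = Re (of_real (Gamma p * a powr (- p)))"
    unfolding F(2) using a powr_of_real[of a "- p"] p by (simp add: Gamma_complex_of_real)
  finally show "integral\<^sup>L lborel f = Gamma p * a powr (- p)" by simp
qed

text \<open>
  Euler's Beta integral over the half-line, with a complex exponent. Writing
  \<open>m! / (t + 1)\<^bsup>m + 1\<^esup>\<close> as the Laplace transform of \<open>x\<^bsup>m\<^esup>\<close> at \<open>t + 1\<close> and exchanging the integrals
  leaves two Gamma integrals.
\<close>

lemma Beta_kernel:
  fixes s :: complex and m :: nat
  assumes s: "Re s > -1" and m: "Re s < real m"
  defines "f \<equiv> \<lambda>t::real. indicator {0<..} t *\<^sub>R (of_real t powr s * (fact m / of_real (t + 1) ^ Suc m) :: complex)"
  shows "integrable lborel f" and "integral\<^sup>L lborel f = Gamma (s + 1) * Gamma (of_nat m - s)"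
proof -
  define F where "F = (\<lambda>(x::real, t::real). (indicator {0<..} x * indicator {0<..} t) *\<^sub>R
     (of_real t powr s * (of_real x powr (of_nat m) * exp (- of_real (x * (t + 1)))) :: complex))"
  have meas [measurable]: "F \<in> borel_measurable (lborel \<Otimes>\<^sub>M lborel)"
    unfolding F_def split_beta by measurable
  have Fx: "F (x, t) = (indicator {0<..} x *\<^sub>R (of_real x powr of_nat m * exp (- of_real x))) *
       (indicator {0<..} t *\<^sub>R (of_real t powr ((s + 1) - 1) * exp (- of_real (x * t))))" for x t
    by (simp add: F_def algebra_simps exp_add exp_diff exp_minus indicator_def field_simps)
  have Ft: "F (x, t) = (indicator {0<..} t *\<^sub>R of_real t powr s) *
       (indicator {0<..} x *\<^sub>R (of_real x powr ((of_nat m + 1) - 1) * exp (- of_real ((t + 1) * x))))" for x t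
    by (simp add: F_def algebra_simps indicator_def)
  have inner: "integral\<^sup>L lborel (\<lambda>t. F (x, t)) =
      Gamma (s + 1) * (indicator {0<..} x *\<^sub>R (of_real x powr ((of_nat m - s) - 1) * exp (- of_real x)))" for x
  proof (cases "x > 0")
    case True
    have "integral\<^sup>L lborel (\<lambda>t. F (x, t)) = (of_real x powr of_nat m * exp (- of_real x)) *
        (Gamma (s + 1) * of_real x powr (- (s + 1)))"
      unfolding Fx using Gamma_kernel[of "s + 1" x] s True
      by (simp del: mult_scaleR_right mult_scaleR_left)
    also have "\<dots> = Gamma (s + 1) * (of_real x powr (of_nat m + (- (s + 1))) * exp (- of_real x))"
      using True by (simp only: powr_add mult_ac)
    finally show ?thesis using True by (simp add: algebra_simps)
  qed (simp add: Fx)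
  have innern: "integral\<^sup>L lborel (\<lambda>t. norm (F (x, t))) =
      Gamma (Re s + 1) * (indicator {0<..} x * (x powr ((real m - Re s) - 1) * exp (- (1 * x))))" for x
  proof (cases "x > 0")
    case True
    have "norm (F (x, t)) = (x powr real m * exp (- x)) *
        (indicator {0<..} t * (t powr ((Re s + 1) - 1) * exp (- (x * t))))" for t
      using True by (auto simp: Fx norm_mult norm_power norm_powr_real_powr indicator_def powr_realpow)
    then have "integral\<^sup>L lborel (\<lambda>t. norm (F (x, t))) = (x powr real m * exp (- x)) *
        (Gamma (Re s + 1) * x powr (- (Re s + 1)))"
      using Gamma_kernel_norm[of "Re s + 1" x] s True by simp
    also have "\<dots> = Gamma (Re s + 1) * (x powr (real m + (- (Re s + 1))) * exp (- x))"
      using True by (simp only: powr_add mult_ac)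
    finally show ?thesis using True by (simp add: algebra_simps)
  qed (simp add: Fx)
  have F: "integrable (lborel \<Otimes>\<^sub>M lborel) F"
  proof (rule lborel_pair.Fubini_integrable[OF meas])
    show "integrable lborel (\<lambda>x. integral\<^sup>L lborel (\<lambda>t. norm (F (x, t))))"
      unfolding innern using Gamma_kernel_norm(1)[of "real m - Re s" 1] m by (intro integrable_mult_right) simp
    show "AE x in lborel. integrable lborel (\<lambda>t. F (x, t))"
    proof (rule AE_I2)
      fix x show "integrable lborel (\<lambda>t. F (x, t))"
        unfolding Fx
        by (cases "x > 0")
           (use Gamma_kernel(1)[of "s + 1" x] s in \<open>auto intro!: integrable_mult_right simp del: mult_scaleR_right mult_scaleR_left\<close>)
    qed
  qed
  have outer: "integral\<^sup>L lborel (\<lambda>x. F (x, t)) = f t" for t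
  proof (cases "t > 0")
    case True
    have "integral\<^sup>L lborel (\<lambda>x. F (x, t)) = of_real t powr s *
       (Gamma (of_nat m + 1) * of_real (t + 1) powr (- (of_nat m + 1)))"
      unfolding Ft using Gamma_kernel[of "of_nat m + 1" "t + 1"] True
      by (simp del: mult_scaleR_right mult_scaleR_left)
    also have "(of_real (t + 1) :: complex) powr (- (of_nat m + 1)) = inverse (of_real (t + 1) ^ Suc m)"
      using True powr_nat'[of "of_real (t+1) :: complex" "Suc m"]
      by (subst powr_minus) (simp add: add.commute del: power_Suc of_real_add)
    finally show ?thesis using True
      by (simp add: f_def Gamma_fact[symmetric] add.commute divide_inverse del: power_Suc)
  qed (simp add: Ft f_def)
  have "integrable lborel (\<lambda>t. integral\<^sup>L lborel (\<lambda>x. F (x, t)))"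
    using lborel_pair.integrable_snd[of "\<lambda>x t. F (x, t)"] F by simp
  then show "integrable lborel f" by (simp add: outer)
  have "integral\<^sup>L lborel f = integral\<^sup>L lborel (\<lambda>t. integral\<^sup>L lborel (\<lambda>x. F (x, t)))"
    by (simp add: outer)
  also have "\<dots> = integral\<^sup>L lborel (\<lambda>x. integral\<^sup>L lborel (\<lambda>t. F (x, t)))"
    using lborel_pair.Fubini_integral[of "\<lambda>x t. F (x, t)"] F by simp
  also have "\<dots> = Gamma (s + 1) * Gamma (of_nat m - s)"
    unfolding inner using Gamma_kernel_unit[of "of_nat m - s"] m
    by (simp del: mult_scaleR_right mult_scaleR_left)
  finally show "integral\<^sup>L lborel f = Gamma (s + 1) * Gamma (of_nat m - s)" .
qed

section \<open>Taylor coefficients of the regular part\<close>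

text \<open>
  Up to sign and factorial, \<open>regular_coeff (s - j)\<close> is the \<open>j\<close>-th Taylor coefficient at 1 of the
  regular part of order \<open>s\<close>. The point 1 is arbitrary: it lies in the half-plane, where everything
  is explicit, and 0 lies within the radius of convergence 2 that is established here.
\<close>

definition regular_coeff :: "complex \<Rightarrow> complex" where
  "regular_coeff s = regular_part s 1"

text \<open>
  Termwise integration against \<open>t\<^bsup>s\<^esup>\<close> multiplies the \<open>n\<close>-th term by \<open>\<Gamma>(s + 1) n\<^bsup>- s - 1\<^esup>\<close>. This is
  how fractional orders are reached from integer orders.
\<close>

lemma exp_dirichlet_Mellin:
  fixes s :: complex and m :: nat
  assumes s: "Re s > -1"
  defines "f \<equiv> \<lambda>t::real. indicator {0<..} t *\<^sub>R (of_real t powr s * exp_dirichlet (- of_nat m) (of_real (t + 1)))"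
  shows "integrable lborel f"
    and "integral\<^sup>L lborel f = Gamma (s + 1) * exp_dirichlet (s + 1 - of_nat m) 1"
proof -
  define c where "c = (\<lambda>n. of_nat (Suc n) powr of_nat m * exp (- of_nat (Suc n)) :: complex)"
  define F where "F = (\<lambda>n t. c n * (indicator {0<..} t *\<^sub>R
      (of_real t powr ((s + 1) - 1) * exp (- of_real (real (Suc n) * t)))) :: complex)"
  define G where "G = (\<lambda>n t. norm (c n) * (indicator {0<..} t * (t powr ((Re s + 1) - 1) * exp (- (real (Suc n) * t)))))"
  have nFG: "norm (F n t) = G n t" for n t
    by (auto simp: F_def G_def norm_mult norm_powr_real_powr indicator_def)
  have F_int: "integrable lborel (F n)" for n
    unfolding F_def using s by (intro integrable_mult_right Gamma_kernel) auto
  have F_val: "integral\<^sup>L lborel (F n) = Gamma (s + 1) * (of_nat (Suc n) powr (- (s + 1 - of_nat m)) * exp (- of_nat (Suc n) * 1))" for n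
  proof -
    have "integral\<^sup>L lborel (F n) = c n * (Gamma (s + 1) * of_real (real (Suc n)) powr (- (s + 1)))"
      unfolding F_def integral_mult_right_zero using s by (subst Gamma_kernel(2)) auto
    also have "\<dots> = Gamma (s + 1) * ((of_nat (Suc n) powr (of_nat m + - (s + 1))) * exp (- of_nat (Suc n) * 1))"
      unfolding c_def powr_add by (simp only: mult_1_right of_real_of_nat_eq) (simp only: mult_ac)
    also have "of_nat m + - (s + 1) = - (s + 1 - of_nat m)" by simp
    finally show ?thesis .
  qed
  have G_val: "integral\<^sup>L lborel (G n) = Gamma (Re s + 1) * (real (Suc n) powr (real m - Re s - 1) * exp (- real (Suc n) * 1))" for n
  proof -
    have "norm (c n) = real (Suc n) powr real m * exp (- real (Suc n))"
      using norm_exp_dirichlet_term[of n "- of_nat m" 1] by (simp add: c_def del: of_nat_Suc)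
    then have "integral\<^sup>L lborel (G n) = real (Suc n) powr real m * exp (- real (Suc n)) * (Gamma (Re s + 1) * real (Suc n) powr (- (Re s + 1)))"
      unfolding G_def integral_mult_right_zero using s by (subst Gamma_kernel_norm(2)) auto
    also have "\<dots> = Gamma (Re s + 1) * ((real (Suc n) powr (real m + - (Re s + 1))) * exp (- real (Suc n) * 1))"
      unfolding powr_add by (simp only: mult_1_right) (simp only: mult_ac)
    also have "real m + - (Re s + 1) = real m - Re s - 1" by simp
    finally show ?thesis .
  qed
  have f: "(\<lambda>n. F n t) sums f t" for t
  proof (cases "t > 0")
    case True
    have "(\<lambda>n. of_real t powr s * (of_nat (Suc n) powr (- (- of_nat m)) * exp (- of_nat (Suc n) * of_real (t + 1))))
       sums (of_real t powr s * exp_dirichlet (- of_nat m) (of_real (t + 1)))"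
      using True by (intro sums_mult exp_dirichlet_sums) simp
    moreover have "F n t = of_real t powr s * (of_nat (Suc n) powr (- (- of_nat m)) * exp (- of_nat (Suc n) * of_real (t + 1)))" for n
      using True by (simp add: F_def c_def ring_distribs exp_add exp_diff exp_minus divide_inverse mult_ac del: of_nat_Suc)
    ultimately show ?thesis using True by (simp add: f_def)
  qed (simp add: F_def f_def)
  have summ: "AE t in lborel. summable (\<lambda>n. norm (F n t))"
  proof (rule AE_I2)
    fix t :: real
    show "summable (\<lambda>n. norm (F n t))"
    proof (cases "t > 0")
      case True
      have "summable (\<lambda>n. t powr Re s * (real (Suc n) powr real m * exp (- real (Suc n) * (t + 1))))"
        using True by (intro summable_mult summable_powr_exp) simp
      moreover have "norm (F n t) = t powr Re s * (real (Suc n) powr real m * exp (- real (Suc n) * (t + 1)))" for n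
      proof -
        have "norm (c n) = real (Suc n) powr real m * exp (- real (Suc n))"
          using norm_exp_dirichlet_term[of n "- of_nat m" 1] by (simp add: c_def del: of_nat_Suc)
        then show ?thesis using True
          by (simp add: nFG G_def ring_distribs exp_add exp_diff exp_minus divide_inverse mult_ac del: of_nat_Suc)
      qed
      ultimately show ?thesis by simp
    qed (simp add: F_def)
  qed
  have summ2: "summable (\<lambda>n. integral\<^sup>L lborel (\<lambda>t. norm (F n t)))"
    unfolding nFG G_val by (intro summable_mult summable_powr_exp) simp
  have f_eq: "f = (\<lambda>t. \<Sum>n. F n t)" using f by (auto simp: sums_iff)
  show "integrable lborel f"
    unfolding f_eq by (rule integrable_suminf[OF F_int summ summ2])
  have "integral\<^sup>L lborel f = (\<Sum>n. integral\<^sup>L lborel (F n))"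
    unfolding f_eq by (rule integral_suminf[OF F_int summ summ2])
  also have "\<dots> = Gamma (s + 1) * exp_dirichlet (s + 1 - of_nat m) 1"
    unfolding F_val using exp_dirichlet_sums[of 1 "s + 1 - of_nat m"]
    by (intro sums_unique[symmetric] sums_mult) simp
  finally show "integral\<^sup>L lborel f = Gamma (s + 1) * exp_dirichlet (s + 1 - of_nat m) 1" .
qed

text \<open>
  By the Beta integral, the singular terms correspond to each other in the same way. Starting from the
  integer order \<open>- 1\<close> instead of 0 allows the kernel \<open>t\<^bsup>s\<^esup>\<close> in place of \<open>t\<^bsup>s - 1\<^esup>\<close>, and so the strip
  \<open>- 1 < Re s < 1\<close> in place of \<open>0 < Re s < 1\<close>. It is wider than 1, so its translates by integers cover
  the plane with overlaps.
\<close>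

lemma regular_coeff_Mellin:
  fixes s :: complex and j :: nat
  assumes s: "Re s > -1" "Re s < 1"
  defines "f \<equiv> \<lambda>t::real. indicator {0<..} t *\<^sub>R (of_real t powr s * regular_part (- of_nat (Suc j)) (of_real (t + 1)))"
  shows "integrable lborel f"
    and "integral\<^sup>L lborel f = Gamma (s + 1) * regular_coeff (s - of_nat j)"
proof -
  define f1 where "f1 = (\<lambda>t::real. indicator {0<..} t *\<^sub>R (of_real t powr s * exp_dirichlet (- of_nat (Suc j)) (of_real (t + 1))))"
  define f2 where "f2 = (\<lambda>t::real. indicator {0<..} t *\<^sub>R (of_real t powr s * (fact (Suc j) / of_real (t + 1) ^ Suc (Suc j)) :: complex))"
  have f1: "integrable lborel f1" "integral\<^sup>L lborel f1 = Gamma (s + 1) * exp_dirichlet (s + 1 - of_nat (Suc j)) 1"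
    unfolding f1_def using s by (intro exp_dirichlet_Mellin; simp)+
  have f2: "integrable lborel f2" "integral\<^sup>L lborel f2 = Gamma (s + 1) * Gamma (of_nat (Suc j) - s)"
    unfolding f2_def using s by (intro Beta_kernel; simp)+
  have f: "f t = f1 t - f2 t" for t
  proof (cases "t > 0")
    case True
    have "Gamma (1 - (- of_nat (Suc j))) = (fact (Suc j) :: complex)"
      using Gamma_fact[of "Suc j"] by (simp add: algebra_simps)
    moreover have "(of_real (t + 1) :: complex) powr (- of_nat (Suc j) - 1) = inverse (of_real (t + 1) ^ Suc (Suc j))"
    proof -
      have "(of_real (t + 1) :: complex) powr (- of_nat (Suc (Suc j))) = inverse (of_real (t + 1) powr of_nat (Suc (Suc j)))"
        by (rule powr_minus)
      also have "(of_real (t + 1) :: complex) powr of_nat (Suc (Suc j)) = of_real (t + 1) ^ Suc (Suc j)"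
        using True by (intro powr_nat') (auto simp del: of_real_add)
      also have "- of_nat (Suc (Suc j)) = (- of_nat (Suc j) - 1 :: complex)" by simp
      finally show ?thesis .
    qed
    ultimately have "regular_part (- of_nat (Suc j)) (of_real (t + 1)) =
       exp_dirichlet (- of_nat (Suc j)) (of_real (t + 1)) - fact (Suc j) / of_real (t + 1) ^ Suc (Suc j)"
      by (simp only: regular_part_def divide_inverse)
    then show ?thesis using True by (simp only: f_def f1_def f2_def) (simp add: algebra_simps)
  qed (simp add: f_def f1_def f2_def)
  show "integrable lborel f"
    unfolding f[abs_def] by (intro Bochner_Integration.integrable_diff f1 f2)
  have "integral\<^sup>L lborel f = integral\<^sup>L lborel f1 - integral\<^sup>L lborel f2"
    unfolding f[abs_def] by (intro Bochner_Integration.integral_diff f1 f2)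
  also have "\<dots> = Gamma (s + 1) * regular_coeff (s - of_nat j)"
    unfolding f1 f2 regular_coeff_def regular_part_def by (simp add: algebra_simps)
  finally show "integral\<^sup>L lborel f = Gamma (s + 1) * regular_coeff (s - of_nat j)" .
qed

text \<open>
  Insert the bound for negative integer orders into the Mellin integral. On the narrower closed strip
  the remaining integral is bounded uniformly, by comparison with the two extreme exponents.
\<close>

lemma regular_coeff_strip_bound:
  obtains B where "B \<ge> 0" and "\<And>s j. \<bar>Re s\<bar> \<le> 3 / 4 \<Longrightarrow>
    norm (regular_coeff (s - of_nat j)) \<le> B * norm (rGamma (s + 1)) * (fact j / 2 ^ j)"
proof -
  obtain C where C: "C \<ge> 0" "\<And>j u. u \<ge> 1 \<Longrightarrow>
    norm (regular_part (- of_nat (Suc j)) (of_real u)) \<le> C * fact j / 2 ^ j / u ^ 2"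
    using regular_part_neg_nat_bound by blast
  define h where "h = (\<lambda>\<sigma> t. indicator {0<..} t * (t powr \<sigma> * (1 / (t + 1) ^ 2)) :: real)"
  have h: "integrable lborel (h \<sigma>)" if "\<bar>\<sigma>\<bar> < 1" for \<sigma>
  proof -
    have "integrable lborel (\<lambda>t::real. norm (indicator {0<..} t *\<^sub>R (of_real t powr (of_real \<sigma>) * (fact 1 / of_real (t + 1) ^ Suc 1) :: complex)))"
      using that by (intro integrable_norm Beta_kernel) auto
    also have "(\<lambda>t::real. norm (indicator {0<..} t *\<^sub>R (of_real t powr (of_real \<sigma>) * (fact 1 / of_real (t + 1) ^ Suc 1) :: complex))) = h \<sigma>"
      by (auto simp: h_def fun_eq_iff indicator_def norm_mult norm_divide norm_powr_real_powr power2_eq_square simp del: of_real_add)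
    finally show ?thesis .
  qed
  define H where "H = (\<lambda>t. h (3/4) t + h (- 3/4) t)"
  have H: "integrable lborel H"
    unfolding H_def by (intro Bochner_Integration.integrable_add h) auto
  have H0: "H t \<ge> 0" for t by (auto simp: H_def h_def indicator_def)
  have hH: "h \<sigma> t \<le> H t" if "\<bar>\<sigma>\<bar> \<le> 3/4" for \<sigma> t
  proof (cases "t > 0")
    case True
    have "t powr \<sigma> \<le> t powr (3/4) + t powr (- 3/4)"
    proof (cases "t \<ge> 1")
      case True
      then have "t powr \<sigma> \<le> t powr (3/4)" using that by (intro powr_mono) auto
      then show ?thesis by (simp add: add_increasing2)
    next
      case False
      then have "t powr \<sigma> \<le> t powr (- 3/4)" using that \<open>t > 0\<close> by (intro powr_mono') auto
      then show ?thesis by (simp add: add_increasing)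
    qed
    then have "t powr \<sigma> * (1 / (t + 1) ^ 2) \<le> (t powr (3/4) + t powr (- 3/4)) * (1 / (t + 1) ^ 2)"
      by (intro mult_right_mono) auto
    then show ?thesis using True by (simp add: H_def h_def add_divide_distrib)
  qed (simp add: H_def h_def)
  define B where "B = C * integral\<^sup>L lborel H"
  show ?thesis
  proof (rule that[of B])
    show "B \<ge> 0" unfolding B_def using C(1) H0 by (intro mult_nonneg_nonneg integral_nonneg) auto
    fix s :: complex and j :: nat assume s: "\<bar>Re s\<bar> \<le> 3 / 4"
    define f where "f = (\<lambda>t::real. indicator {0<..} t *\<^sub>R (of_real t powr s * regular_part (- of_nat (Suc j)) (of_real (t + 1))))"
    have f: "integrable lborel f" "integral\<^sup>L lborel f = Gamma (s + 1) * regular_coeff (s - of_nat j)"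
      unfolding f_def using s by (intro regular_coeff_Mellin; simp)+
    have "norm (f t) \<le> C * fact j / 2 ^ j * H t" for t
    proof (cases "t > 0")
      case True
      have "norm (f t) = t powr Re s * norm (regular_part (- of_nat (Suc j)) (of_real (t + 1)))"
        using True by (simp add: f_def norm_mult norm_powr_real_powr del: of_real_add of_nat_Suc)
      also have "\<dots> \<le> t powr Re s * (C * fact j / 2 ^ j / (t + 1) ^ 2)"
        using True by (intro mult_left_mono C(2)) auto
      also have "\<dots> = C * fact j / 2 ^ j * h (Re s) t" using True by (simp add: h_def)
      also have "\<dots> \<le> C * fact j / 2 ^ j * H t"
        using C(1) s by (intro mult_left_mono hH) auto
      finally show ?thesis .
    next
      case False
      then show ?thesis using H0[of t] C(1) by (simp add: f_def)
    qed
    then have "norm (integral\<^sup>L lborel f) \<le> integral\<^sup>L lborel (\<lambda>t. C * fact j / 2 ^ j * H t)"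
      using f H by (intro Bochner_Integration.integral_norm_bound_integral integrable_mult_right)
    also have "\<dots> = B * (fact j / 2 ^ j)" using H by (simp add: B_def)
    finally have le: "norm (Gamma (s + 1) * regular_coeff (s - of_nat j)) \<le> B * (fact j / 2 ^ j)"
      unfolding f .
    have "s + 1 \<notin> \<int>\<^sub>\<le>\<^sub>0"
    proof
      assume "s + 1 \<in> \<int>\<^sub>\<le>\<^sub>0"
      then obtain n where "s + 1 = - of_nat n" by (auto elim!: nonpos_Ints_cases')
      then have "Re (s + 1) = - real n" by simp
      with s show False by simp
    qed
    then have "rGamma (s + 1) * Gamma (s + 1) = 1"
      by (simp add: rGamma_inverse_Gamma Gamma_eq_zero_iff)
    then have "regular_coeff (s - of_nat j) = rGamma (s + 1) * (Gamma (s + 1) * regular_coeff (s - of_nat j))"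
      by (simp only: mult.assoc[symmetric] mult_1)
    then have "norm (regular_coeff (s - of_nat j)) = norm (rGamma (s + 1)) * norm (Gamma (s + 1) * regular_coeff (s - of_nat j))"
      by (metis norm_mult)
    also have "\<dots> \<le> norm (rGamma (s + 1)) * (B * (fact j / 2 ^ j))"
      using le by (intro mult_left_mono) auto
    finally show "norm (regular_coeff (s - of_nat j)) \<le> B * norm (rGamma (s + 1)) * (fact j / 2 ^ j)"
      by (simp add: mult_ac)
  qed
qed

lemma regular_coeff_holomorphic: "regular_coeff holomorphic_on regular_orders"
proof -
  have "(\<lambda>s. exp_dirichlet s 1) holomorphic_on regular_orders"
    by (rule holomorphic_on_subset[OF exp_dirichlet_holomorphic_order]) auto
  moreover have "(\<lambda>s. Gamma (1 - s)) holomorphic_on regular_orders"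
    by (intro holomorphic_Gamma' holomorphic_intros) (simp add: regular_orders_def)
  ultimately have "(\<lambda>s. exp_dirichlet s 1 - Gamma (1 - s)) holomorphic_on regular_orders"
    by (rule holomorphic_on_diff)
  then show ?thesis by (simp add: regular_coeff_def[abs_def] regular_part_def)
qed

text \<open>
  The Taylor series at 1 of the regular part converges on the disc of radius 2, locally uniformly
  in the order. Quantifying over all radii below 2 makes the property stable under a shift of the
  order by one, which costs a factor \<open>j + 1\<close>.
\<close>

definition coeff_bounded_near :: "complex \<Rightarrow> bool" where
  "coeff_bounded_near s0 \<longleftrightarrow> (\<forall>\<rho>. 0 < \<rho> \<longrightarrow> \<rho> < 2 \<longrightarrow>
     (\<exists>r C. 0 < r \<and> 0 \<le> C \<and> (\<forall>s\<in>ball s0 r. \<forall>j. norm (regular_coeff (s - of_nat j)) \<le> C * fact j / \<rho> ^ j)))"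

lemma coeff_bounded_near_strip:
  assumes "\<bar>Re s0\<bar> \<le> 1 / 2"
  shows "coeff_bounded_near s0"
  unfolding coeff_bounded_near_def
proof (intro allI impI)
  fix \<rho> :: real assume \<rho>: "0 < \<rho>" "\<rho> < 2"
  obtain B where B: "B \<ge> 0" "\<And>s j. \<bar>Re s\<bar> \<le> 3 / 4 \<Longrightarrow>
    norm (regular_coeff (s - of_nat j)) \<le> B * norm (rGamma (s + 1)) * (fact j / 2 ^ j)"
    using regular_coeff_strip_bound by blast
  have "continuous_on (cball s0 (1/4)) (\<lambda>s. rGamma (s + 1))"
    by (intro holomorphic_on_imp_continuous_on holomorphic_intros)
  then have "bounded ((\<lambda>s. rGamma (s + 1)) ` cball s0 (1/4))"
    by (intro compact_imp_bounded compact_continuous_image) auto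
  then obtain R where R: "R > 0" "\<And>s. s \<in> cball s0 (1/4) \<Longrightarrow> norm (rGamma (s + 1)) \<le> R"
    by (auto simp: bounded_pos)
  show "\<exists>r C. 0 < r \<and> 0 \<le> C \<and> (\<forall>s\<in>ball s0 r. \<forall>j. norm (regular_coeff (s - of_nat j)) \<le> C * fact j / \<rho> ^ j)"
  proof (intro exI conjI ballI allI)
    show "0 < (1/4 :: real)" "0 \<le> B * R" using B(1) R(1) by auto
    fix s j assume s: "s \<in> ball s0 (1/4)"
    have "\<bar>Re s\<bar> \<le> 3/4"
      using abs_Re_le_cmod[of "s0 - s"] s assms by (simp add: dist_norm)
    then have "norm (regular_coeff (s - of_nat j)) \<le> B * norm (rGamma (s + 1)) * (fact j / 2 ^ j)"
      by (rule B)
    also have "\<dots> \<le> B * R * (fact j / \<rho> ^ j)"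
      using B(1) R s \<rho> by (intro mult_mono mult_nonneg_nonneg divide_left_mono power_mono) auto
    finally show "norm (regular_coeff (s - of_nat j)) \<le> B * R * fact j / \<rho> ^ j" by simp
  qed
qed

text \<open>
  Lowering the order shifts the index of the coefficients by one; the factor \<open>j + 1\<close> that appears
  is absorbed by a slightly larger radius.
\<close>

lemma coeff_bounded_near_diff_1:
  assumes "coeff_bounded_near s0"
  shows "coeff_bounded_near (s0 - 1)"
  unfolding coeff_bounded_near_def
proof (intro allI impI)
  fix \<rho> :: real assume \<rho>: "0 < \<rho>" "\<rho> < 2"
  define \<rho>' where "\<rho>' = (\<rho> + 2) / 2"
  have \<rho>': "\<rho> < \<rho>'" "0 < \<rho>'" "\<rho>' < 2" using \<rho> by (auto simp: \<rho>'_def)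
  obtain r C where C: "r > 0" "C \<ge> 0"
    "\<And>s j. s \<in> ball s0 r \<Longrightarrow> norm (regular_coeff (s - of_nat j)) \<le> C * fact j / \<rho>' ^ j"
    using assms[unfolded coeff_bounded_near_def, rule_format, OF \<rho>'(2,3)] by blast
  have "(\<lambda>n. of_nat n * (\<rho> / \<rho>') ^ n) \<longlonglongrightarrow> 0"
    using \<rho> \<rho>' by (intro powser_times_n_limit_0) auto
  then have "Bseq (\<lambda>n. of_nat n * (\<rho> / \<rho>') ^ n)" by (intro convergent_imp_Bseq) (auto simp: convergent_def)
  then obtain M where M: "M > 0" "\<And>n. norm (of_nat n * (\<rho> / \<rho>') ^ n) \<le> M" unfolding Bseq_def by blast
  show "\<exists>r C. 0 < r \<and> 0 \<le> C \<and> (\<forall>s\<in>ball (s0 - 1) r. \<forall>j. norm (regular_coeff (s - of_nat j)) \<le> C * fact j / \<rho> ^ j)"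
  proof (intro exI conjI ballI allI)
    show "0 < r" "0 \<le> C * M / \<rho>" using C M \<rho> by auto
    fix s j assume s: "s \<in> ball (s0 - 1) r"
    then have "s + 1 \<in> ball s0 r" by (simp add: dist_norm algebra_simps)
    then have "norm (regular_coeff (s + 1 - of_nat (Suc j))) \<le> C * fact (Suc j) / \<rho>' ^ Suc j" by (rule C)
    also have "\<dots> = C * fact j / \<rho> ^ j * (of_nat (Suc j) * (\<rho> / \<rho>') ^ Suc j) / \<rho>"
      using \<rho> \<rho>' by (simp add: power_divide field_simps)
    also have "\<dots> \<le> C * fact j / \<rho> ^ j * M / \<rho>"
      using M(2)[of "Suc j"] \<rho> \<rho>' C(2)
      by (intro divide_right_mono mult_left_mono) auto
    finally show "norm (regular_coeff (s - of_nat j)) \<le> C * M / \<rho> * fact j / \<rho> ^ j"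
      by (simp add: mult_ac)
  qed
qed

text \<open>
  Raising the order adds a single new coefficient, that of index 0, which is bounded on compact sets
  of orders avoiding the poles of the Gamma factor.
\<close>

lemma coeff_bounded_near_add_1:
  assumes "coeff_bounded_near (s0 - 1)" and "s0 \<in> regular_orders"
  shows "coeff_bounded_near s0"
  unfolding coeff_bounded_near_def
proof (intro allI impI)
  fix \<rho> :: real assume \<rho>: "0 < \<rho>" "\<rho> < 2"
  obtain r C where C: "r > 0" "C \<ge> 0"
    "\<And>s j. s \<in> ball (s0 - 1) r \<Longrightarrow> norm (regular_coeff (s - of_nat j)) \<le> C * fact j / \<rho> ^ j"
    using assms(1)[unfolded coeff_bounded_near_def, rule_format, OF \<rho>] by blast
  obtain e where e: "e > 0" "cball s0 e \<subseteq> regular_orders"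
    using open_regular_orders assms(2) open_contains_cball by blast
  have "continuous_on (cball s0 e) regular_coeff"
    using regular_coeff_holomorphic e(2) holomorphic_on_imp_continuous_on holomorphic_on_subset by blast
  then have "bounded (regular_coeff ` cball s0 e)"
    by (intro compact_imp_bounded compact_continuous_image) auto
  then obtain R where R: "R > 0" "\<And>s. s \<in> cball s0 e \<Longrightarrow> norm (regular_coeff s) \<le> R"
    by (auto simp: bounded_pos)
  show "\<exists>r C. 0 < r \<and> 0 \<le> C \<and> (\<forall>s\<in>ball s0 r. \<forall>j. norm (regular_coeff (s - of_nat j)) \<le> C * fact j / \<rho> ^ j)"
  proof (intro exI conjI ballI allI)
    show "0 < min r e" "0 \<le> max R (C * \<rho>)" using C R e by auto
    fix s j assume s: "s \<in> ball s0 (min r e)"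
    show "norm (regular_coeff (s - of_nat j)) \<le> max R (C * \<rho>) * fact j / \<rho> ^ j"
    proof (cases j)
      case 0
      then show ?thesis using R(2)[of s] s by simp
    next
      case (Suc i)
      have "s - 1 \<in> ball (s0 - 1) r" using s by (simp add: dist_norm)
      then have "norm (regular_coeff (s - 1 - of_nat i)) \<le> C * fact i / \<rho> ^ i" by (rule C)
      also have "\<dots> = C * \<rho> * fact i / \<rho> ^ j" using \<rho> Suc by (simp add: field_simps)
      also have "\<dots> \<le> max R (C * \<rho>) * fact j / \<rho> ^ j"
        using \<rho> Suc C(2) R(1) by (intro divide_right_mono mult_mono fact_mono) (auto simp: le_max_iff_disj)
      finally show ?thesis using Suc by (simp add: algebra_simps)
    qed
  qed
qed

lemma coeff_bounded_near_regular:
  assumes "s0 \<in> regular_orders"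
  shows "coeff_bounded_near s0"
proof -
  have up: "coeff_bounded_near s" if "s \<in> regular_orders" "\<bar>Re (s - of_nat n)\<bar> \<le> 1 / 2" for s n
    using that
  proof (induction n arbitrary: s)
    case 0
    then show ?case by (intro coeff_bounded_near_strip) simp
  next
    case (Suc n)
    then have "coeff_bounded_near (s - 1)"
      by (intro Suc.IH regular_orders_diff_1) (simp_all add: algebra_simps)
    then show ?case using Suc.prems(1) by (rule coeff_bounded_near_add_1)
  qed
  have down: "coeff_bounded_near s" if "\<bar>Re (s + of_nat n)\<bar> \<le> 1 / 2" for s n
    using that
  proof (induction n arbitrary: s)
    case 0
    then show ?case by (intro coeff_bounded_near_strip) simp
  next
    case (Suc n)
    then have "coeff_bounded_near (s + 1)" by (intro Suc.IH) (simp add: algebra_simps)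
    from coeff_bounded_near_diff_1[OF this] show ?case by simp
  qed
  \<comment> \<open>Every order is an integer translate of one with \<open>\<bar>Re s\<bar> \<le> 1 / 2\<close>.\<close>
  define k where "k = round (Re s0)"
  have k: "\<bar>Re s0 - of_int k\<bar> \<le> 1 / 2"
    using of_int_round_abs_le[of "Re s0"] by (simp add: k_def abs_minus_commute)
  show ?thesis
  proof (cases "k \<ge> 0")
    case True
    then show ?thesis using k assms by (intro up[of s0 "nat k"]) auto
  next
    case False
    then show ?thesis using k by (intro down[of s0 "nat (- k)"]) auto
  qed
qed

section \<open>Analytic continuation and the zeta function\<close>

text \<open>
  The Taylor series at 1 of the regular part. Its disc of convergence contains the point 0, which is
  on the boundary of the half-plane on which the regular part is defined.
\<close>

definition regular_extension :: "complex \<Rightarrow> complex \<Rightarrow> complex" where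
  "regular_extension s w = (\<Sum>j. regular_coeff (s - of_nat j) / fact j * (1 - w) ^ j)"

lemma regular_extension_sums:
  assumes s: "s \<in> regular_orders" and w: "w \<in> ball 1 2"
  shows "(\<lambda>j. regular_coeff (s - of_nat j) / fact j * (1 - w) ^ j) sums regular_extension s w"
proof -
  define d where "d = norm (1 - w)"
  define \<rho> where "\<rho> = (d + 2) / 2"
  have d: "0 \<le> d" "d < 2" using w by (auto simp: d_def dist_norm)
  then have \<rho>: "0 < \<rho>" "\<rho> < 2" "d < \<rho>" by (auto simp: \<rho>_def)
  obtain r C where C: "r > 0" "C \<ge> 0"
    "\<And>s' j. s' \<in> ball s r \<Longrightarrow> norm (regular_coeff (s' - of_nat j)) \<le> C * fact j / \<rho> ^ j"
    using coeff_bounded_near_regular[OF s, unfolded coeff_bounded_near_def, rule_format, OF \<rho>(1,2)] by blast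
  have "summable (\<lambda>j. regular_coeff (s - of_nat j) / fact j * (1 - w) ^ j)"
  proof (rule summable_comparison_test')
    show "summable (\<lambda>j. C * (d / \<rho>) ^ j)"
      using d \<rho> by (intro summable_mult summable_geometric) simp
    fix j :: nat
    have "norm (regular_coeff (s - of_nat j) / fact j * (1 - w) ^ j) = norm (regular_coeff (s - of_nat j)) / fact j * d ^ j"
      by (simp add: norm_mult norm_divide norm_power d_def)
    also have "\<dots> \<le> C * fact j / \<rho> ^ j / fact j * d ^ j"
      using C(3)[of s j] C(1) d by (intro mult_right_mono divide_right_mono) auto
    also have "\<dots> = C * (d / \<rho>) ^ j" by (simp add: power_divide)
    finally show "norm (regular_coeff (s - of_nat j) / fact j * (1 - w) ^ j) \<le> C * (d / \<rho>) ^ j" .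
  qed
  then show ?thesis unfolding regular_extension_def by (rule summable_sums)
qed

lemma regular_extension_holomorphic:
  assumes "s \<in> regular_orders"
  shows "regular_extension s holomorphic_on ball 1 2"
proof (rule power_series_holomorphic)
  fix w :: complex assume "w \<in> ball 1 2"
  from regular_extension_sums[OF assms this]
  show "(\<lambda>j. ((- 1) ^ j * regular_coeff (s - of_nat j) / fact j) * (w - 1) ^ j) sums regular_extension s w"
  proof (rule sums_cong[THEN iffD1, rotated])
    fix j
    have "(1 - w) ^ j = (- 1) ^ j * (w - 1) ^ j" by (simp flip: power_mult_distrib)
    then show "regular_coeff (s - of_nat j) / fact j * (1 - w) ^ j = ((- 1) ^ j * regular_coeff (s - of_nat j) / fact j) * (w - 1) ^ j"
      by simp
  qed
qed

lemma ball_1_1_subset: "ball 1 1 \<subseteq> {w. Re w > 0}"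
proof
  fix w :: complex assume "w \<in> ball 1 1"
  then show "w \<in> {w. Re w > 0}"
    using abs_Re_le_cmod[of "1 - w"] by (simp add: dist_norm)
qed

lemma regular_extension_eq:
  assumes s: "s \<in> regular_orders" and w: "w \<in> ball 1 2" "Re w > 0"
  shows "regular_extension s w = regular_part s w"
proof -
  \<comment> \<open>On the disc of radius 1, which lies in the half-plane, this is Taylor's theorem.\<close>
  have eq: "regular_extension s w = regular_part s w" if w: "w \<in> ball 1 1" for w
  proof -
    have "regular_part s holomorphic_on ball 1 1"
      using regular_part_holomorphic[OF s] ball_1_1_subset by (rule holomorphic_on_subset)
    from holomorphic_power_series[OF this w]
    have "(\<lambda>j. (deriv ^^ j) (regular_part s) 1 / fact j * (w - 1) ^ j) sums regular_part s w" .
    moreover have "(deriv ^^ j) (regular_part s) 1 / fact j * (w - 1) ^ j = regular_coeff (s - of_nat j) / fact j * (1 - w) ^ j" for j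
    proof -
      have "(1 - w) ^ j = (- 1) ^ j * (w - 1) ^ j" by (simp flip: power_mult_distrib)
      then show ?thesis
        using higher_deriv_regular_part[OF s, of 1 j] by (simp add: regular_coeff_def)
    qed
    ultimately have "(\<lambda>j. regular_coeff (s - of_nat j) / fact j * (1 - w) ^ j) sums regular_part s w" by simp
    then show ?thesis unfolding regular_extension_def by (simp add: sums_iff)
  qed
  show ?thesis
  proof (rule analytic_continuation_open[where s = "ball 1 1" and s' = "ball 1 2 \<inter> {w. Re w > 0}"
        and f = "regular_extension s" and g = "regular_part s"])
    show "connected (ball 1 2 \<inter> {w::complex. Re w > 0})"
      by (intro convex_connected convex_Int convex_ball convex_halfspace_Re_gt)
    show "regular_extension s holomorphic_on ball 1 2 \<inter> {w. Re w > 0}"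
      using regular_extension_holomorphic[OF s] by (rule holomorphic_on_subset) auto
    show "regular_part s holomorphic_on ball 1 2 \<inter> {w. Re w > 0}"
      using regular_part_holomorphic[OF s] by (rule holomorphic_on_subset) auto
    show "ball 1 1 \<subseteq> ball 1 2 \<inter> {w::complex. Re w > 0}"
      using ball_1_1_subset subset_ball[of 1 2 "1::complex"] by auto
  qed (use w eq in \<open>auto simp: open_halfspace_Re_gt intro!: open_Int\<close>)
qed

text \<open>
  The differentiation rule persists by the identity theorem.
\<close>

lemma deriv_regular_extension:
  assumes s: "s \<in> regular_orders" and w: "w \<in> ball 1 2"
  shows "deriv (regular_extension s) w = - regular_extension (s - 1) w"
proof (rule analytic_continuation_open[where s = "ball 1 1" and s' = "ball 1 2"
      and f = "deriv (regular_extension s)" and g = "\<lambda>w. - regular_extension (s - 1) w"])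
  show "deriv (regular_extension s) holomorphic_on ball 1 2"
    by (intro holomorphic_deriv regular_extension_holomorphic s) auto
  show "(\<lambda>w. - regular_extension (s - 1) w) holomorphic_on ball 1 2"
    by (intro holomorphic_intros regular_extension_holomorphic regular_orders_diff_1 s)
  fix z :: complex assume z: "z \<in> ball 1 1"
  then have z': "z \<in> ball 1 2" "Re z > 0" using ball_1_1_subset by auto
  have "(regular_part s has_field_derivative - regular_part (s - 1) z) (at z)"
    by (intro regular_part_has_derivative s z')
  then have "(regular_extension s has_field_derivative - regular_part (s - 1) z) (at z)"
  proof (rule has_field_derivative_transform_within_open[OF _ open_ball z])
    fix x :: complex assume "x \<in> ball 1 1"
    then show "regular_part s x = regular_extension s x"
      using ball_1_1_subset by (intro regular_extension_eq[OF s, symmetric]) auto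
  qed
  then show "deriv (regular_extension s) z = - regular_extension (s - 1) z"
    using regular_extension_eq[OF regular_orders_diff_1[OF s] z'] by (simp add: DERIV_imp_deriv)
qed (use w in auto)

lemma higher_deriv_regular_extension:
  assumes s: "s \<in> regular_orders" and w: "w \<in> ball 1 2"
  shows "(deriv ^^ n) (regular_extension s) w = (- 1) ^ n * regular_extension (s - of_nat n) w"
  using w
proof (induction n arbitrary: w)
  case (Suc n)
  have sn: "s - of_nat n \<in> regular_orders" by (intro regular_orders_diff s)
  have "regular_extension (s - of_nat n) field_differentiable at w"
    using regular_extension_holomorphic[OF sn] Suc.prems by (auto intro: holomorphic_on_imp_differentiable_at)
  then have "((\<lambda>w. (- 1) ^ n * regular_extension (s - of_nat n) w) has_field_derivative
      (- 1) ^ n * - regular_extension (s - of_nat n - 1) w) (at w)"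
    using deriv_regular_extension[OF sn Suc.prems] by (intro DERIV_cmult) (metis DERIV_deriv_iff_field_differentiable)
  then have "((deriv ^^ n) (regular_extension s) has_field_derivative
      (- 1) ^ n * - regular_extension (s - of_nat n - 1) w) (at w)"
    by (rule has_field_derivative_transform_within_open[OF _ open_ball]) (use Suc in auto)
  from DERIV_imp_deriv[OF this] show ?case by (simp add: algebra_simps)
qed simp

text \<open>
  The coefficients are explicit holomorphic functions of the order, and the bound on them is locally
  uniform; so the value at 0 is a holomorphic function of the order. It is the zeta function, as
  the next lemmas show.
\<close>

lemma regular_extension_0_holomorphic: "(\<lambda>s. regular_extension s 0) holomorphic_on regular_orders"
proof -
  define f where "f = (\<lambda>j s. regular_coeff (s - of_nat j) / fact j)"
  have f_holo: "f j holomorphic_on regular_orders" for j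
    unfolding f_def
  proof (intro holomorphic_intros)
    have "(regular_coeff \<circ> (\<lambda>s. s - of_nat j)) holomorphic_on regular_orders"
      by (intro holomorphic_on_compose_gen[OF _ regular_coeff_holomorphic] holomorphic_intros)
         (auto intro: regular_orders_diff)
    then show "(\<lambda>s. regular_coeff (s - of_nat j)) holomorphic_on regular_orders" by (simp add: o_def)
  qed auto
  have "\<exists>g g'. \<forall>x\<in>regular_orders. ((\<lambda>n. f n x) sums g x) \<and> ((\<lambda>n. deriv (f n) x) sums g' x) \<and> (g has_field_derivative g' x) (at x)"
  proof (rule series_and_derivative_comparison_local)
    show "open regular_orders" by (rule open_regular_orders)
    show "(f n has_field_derivative deriv (f n) x) (at x)" if "x \<in> regular_orders" for n x
      using f_holo open_regular_orders that by (rule holomorphic_derivI)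
    fix x assume x: "x \<in> regular_orders"
    obtain r C where C: "r > 0" "C \<ge> 0"
      "\<And>s j. s \<in> ball x r \<Longrightarrow> norm (regular_coeff (s - of_nat j)) \<le> C * fact j / (3 / 2) ^ j"
      using coeff_bounded_near_regular[OF x, unfolded coeff_bounded_near_def, rule_format, of "3 / 2"] by auto
    show "\<exists>d h. 0 < d \<and> summable h \<and> (\<forall>\<^sub>F n in sequentially. \<forall>y\<in>ball x d \<inter> regular_orders. norm (f n y) \<le> h n)"
    proof (intro exI conjI always_eventually allI ballI)
      show "0 < r" by fact
      show "summable (\<lambda>j. C * (2 / 3) ^ j)" by (intro summable_mult summable_geometric) simp
      fix n y assume "y \<in> ball x r \<inter> regular_orders"
      then have "norm (regular_coeff (y - of_nat n)) / fact n \<le> C * fact n / (3 / 2) ^ n / fact n"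
        by (intro divide_right_mono C(3)) auto
      then have "norm (f n y) \<le> C * fact n / (3 / 2) ^ n / fact n" by (simp add: f_def norm_divide)
      then show "norm (f n y) \<le> C * (2 / 3) ^ n" by (simp add: power_divide)
    qed
  qed
  then obtain g g' where g: "\<And>x. x \<in> regular_orders \<Longrightarrow> (\<lambda>n. f n x) sums g x"
    "\<And>x. x \<in> regular_orders \<Longrightarrow> (g has_field_derivative g' x) (at x)" by auto
  have "g s = regular_extension s 0" if "s \<in> regular_orders" for s
    using sums_unique[OF g(1)[OF that]] by (simp add: f_def regular_extension_def)
  moreover have "g holomorphic_on regular_orders"
    using g(2) by (auto simp: holomorphic_on_open open_regular_orders)
  ultimately show ?thesis by (auto intro: holomorphic_transform)
qed

text \<open>
  Constants of integration and values at 0 are identified by approaching 0 along the positive reals.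
\<close>

lemma tendsto_of_real_at_right:
  assumes "(f \<longlongrightarrow> l) (at 0 within {w::complex. Re w > 0})"
  shows "((\<lambda>x::real. f (of_real x)) \<longlongrightarrow> l) (at_right 0)"
proof (rule filterlim_compose[OF assms])
  show "filterlim complex_of_real (at 0 within {w. Re w > 0}) (at_right 0)"
    unfolding filterlim_at
    by (auto simp: eventually_at_right_less intro!: tendsto_eq_intros
             eventually_mono[OF eventually_at_right_less[of 0]])
qed

text \<open>
  For \<open>Re s > 1\<close> the singular term \<open>\<Gamma>(1 - s) w\<^bsup>s - 1\<^esup>\<close> vanishes at 0.
\<close>

lemma regular_extension_0_eq_Dirichlet:
  assumes s: "s \<in> regular_orders" and Re: "Re s > 1"
  shows "regular_extension s 0 = exp_dirichlet s 0"
proof (rule tendsto_unique)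
  show "((\<lambda>x::real. regular_extension s (of_real x)) \<longlongrightarrow> regular_extension s 0) (at_right 0)"
  proof -
    have "isCont (regular_extension s) 0"
      using regular_extension_holomorphic[OF s]
      by (intro field_differentiable_imp_continuous_at holomorphic_on_imp_differentiable_at[of _ "ball 1 2"]) auto
    then have "(regular_extension s \<longlongrightarrow> regular_extension s 0) (at 0 within {w. Re w > 0})"
      unfolding isCont_def by (rule tendsto_mono[OF at_le, rotated]) simp
    then show ?thesis by (rule tendsto_of_real_at_right)
  qed
  have "((\<lambda>x::real. exp_dirichlet s (of_real x) - Gamma (1 - s) * of_real x powr (s - 1)) \<longlongrightarrow>
      exp_dirichlet s 0 - Gamma (1 - s) * 0) (at_right 0)"
  proof (intro tendsto_intros tendsto_powr_complex_0)
    show "((\<lambda>x. exp_dirichlet s (complex_of_real x)) \<longlongrightarrow> exp_dirichlet s 0) (at_right 0)"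
      using Re by (intro tendsto_of_real_at_right exp_dirichlet_tendsto_0)
    show "(complex_of_real \<longlongrightarrow> 0) (at_right 0)" by (auto intro!: tendsto_eq_intros)
  qed (use Re in auto)
  moreover have "\<forall>\<^sub>F x in at_right (0::real). regular_extension s (of_real x) = exp_dirichlet s (of_real x) - Gamma (1 - s) * of_real x powr (s - 1)"
    unfolding eventually_at_right_field
  proof (intro exI conjI allI impI)
    show "0 < (1::real)" by simp
    fix x :: real assume "0 < x" "x < 1"
    then have "of_real x \<in> ball (1::complex) 2"
      using norm_of_real[of "1 - x", where ?'a = complex] by (simp add: dist_norm)
    then show "regular_extension s (of_real x) = exp_dirichlet s (of_real x) - Gamma (1 - s) * of_real x powr (s - 1)"
      using \<open>0 < x\<close> by (subst regular_extension_eq[OF s]) (auto simp: regular_part_def)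
  qed
  ultimately show "((\<lambda>x::real. regular_extension s (of_real x)) \<longlongrightarrow> exp_dirichlet s 0) (at_right 0)"
    by (subst tendsto_cong) auto
qed simp

lemma Re_gt_1_or_regular: "s \<noteq> 1 \<Longrightarrow> Re s > 1 \<or> s \<in> regular_orders"
proof (rule ccontr)
  assume s: "s \<noteq> 1" "\<not> (Re s > 1 \<or> s \<in> regular_orders)"
  then obtain n where n: "1 - s = - of_nat n"
    by (auto simp: regular_orders_def elim!: nonpos_Ints_cases')
  then have "Re (1 - s) = - real n" by simp
  with s(2) have "n = 0" by simp
  with n s(1) show False by simp
qed

text \<open>
  The two descriptions cover the plane without the point 1 and agree where both apply, so together
  they are the analytic continuation of the Dirichlet series. It is unique by the identity theorem,
  and so it is the function selected by the definition of \<open>zeta\<close>.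
\<close>

lemma zeta_eq_Dirichlet: "\<And>s. Re s > 1 \<Longrightarrow> zeta s = exp_dirichlet s 0"
  and zeta_eq_regular_extension: "\<And>s. s \<in> regular_orders \<Longrightarrow> zeta s = regular_extension s 0"
proof -
  define P where "P = (\<lambda>f::complex \<Rightarrow> complex. f holomorphic_on (- {1}) \<and>
                  (\<forall>s. Re s > 1 \<longrightarrow> f s = (\<Sum>n. 1 / of_nat (Suc n) powr s)) \<and> f 1 = 0)"
  have D: "(\<Sum>n. 1 / of_nat (Suc n) powr s) = exp_dirichlet s 0" for s
    unfolding exp_dirichlet_def by (simp add: powr_minus divide_inverse)
  define f where "f = (\<lambda>s. if s = 1 then 0 else if Re s > 1 then exp_dirichlet s 0 else regular_extension s 0)"
  have "1 \<notin> regular_orders" by (simp add: regular_orders_def)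
  then have f_reg: "f s = regular_extension s 0" if "s \<in> regular_orders" for s
    using that regular_extension_0_eq_Dirichlet[OF that] by (auto simp: f_def)
  have f_Dir: "f s = exp_dirichlet s 0" if "Re s > 1" for s
    using that by (auto simp: f_def)
  have "f holomorphic_on regular_orders"
    using regular_extension_0_holomorphic f_reg by (auto intro: holomorphic_transform)
  moreover have "f holomorphic_on {s. Re s > 1}"
    using Dirichlet_holomorphic f_Dir by (auto intro: holomorphic_transform)
  ultimately have "f holomorphic_on {s. Re s > 1} \<union> regular_orders"
    by (intro holomorphic_on_Un open_halfspace_Re_gt open_regular_orders)
  then have f_holo: "f holomorphic_on (- {1})"
    by (rule holomorphic_on_subset) (use Re_gt_1_or_regular in auto)
  then have Pf: "P f" unfolding P_def D using f_Dir by (auto simp: f_def)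
  have "g = f" if g: "P g" for g
  proof
    fix s
    show "g s = f s"
    proof (cases "s = 1")
      case False
      show ?thesis
      proof (rule analytic_continuation_open[where s = "{s. Re s > 1}" and s' = "- {1}" and f = g and g = f])
        show "{s. Re s > 1} \<noteq> {}" by (auto intro: exI[of _ 2])
        show "connected (- {1::complex})" by (rule connected_punctured_universe) simp
      qed (use False Pf g in \<open>auto simp: P_def open_halfspace_Re_gt\<close>)
    qed (use Pf g in \<open>auto simp: P_def\<close>)
  qed
  with Pf have "zeta = f" unfolding zeta_def P_def[symmetric] by (intro the_equality)
  with f_Dir f_reg show
    "\<And>s. Re s > 1 \<Longrightarrow> zeta s = exp_dirichlet s 0"
    "\<And>s. s \<in> regular_orders \<Longrightarrow> zeta s = regular_extension s 0" by auto
qed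

section \<open>Expansion of a single polylogarithm\<close>

lemma polylog_eq_exp_dirichlet:
  "polylog \<alpha> (exp (- w)) = exp_dirichlet (of_real \<alpha>) w"
proof -
  have "exp (- w) ^ Suc n / of_real (real (Suc n) powr \<alpha>) = of_nat (Suc n) powr (- of_real \<alpha>) * exp (- of_nat (Suc n) * w)" for n
  proof -
    have "exp (- w) ^ Suc n = exp (- of_nat (Suc n) * w)"
      using exp_of_nat_mult[of "Suc n" "- w"] by (simp del: power_Suc of_nat_Suc)
    moreover have "(of_real (real (Suc n) powr \<alpha>) :: complex) = of_nat (Suc n) powr of_real \<alpha>"
      using powr_of_real[of "real (Suc n)" \<alpha>] by simp
    ultimately show ?thesis by (simp add: powr_minus divide_inverse)
  qed
  then show ?thesis unfolding polylog_def exp_dirichlet_def by simp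
qed

lemma regular_orders_of_real:
  "of_real \<alpha> \<in> regular_orders \<longleftrightarrow> \<not> (\<exists>m::nat. m \<ge> 1 \<and> \<alpha> = real m)"
proof -
  have "1 - of_real \<alpha> \<in> (\<int>\<^sub>\<le>\<^sub>0 :: complex set) \<longleftrightarrow> (\<exists>m::nat. m \<ge> 1 \<and> \<alpha> = real m)"
  proof
    assume "1 - of_real \<alpha> \<in> (\<int>\<^sub>\<le>\<^sub>0 :: complex set)"
    then obtain n where "1 - of_real \<alpha> = (- of_nat n :: complex)" by (auto elim!: nonpos_Ints_cases')
    then have "Re (1 - of_real \<alpha>) = Re (- of_nat n)" by (rule arg_cong)
    then have "\<alpha> = real (Suc n)" by simp
    then show "\<exists>m::nat. m \<ge> 1 \<and> \<alpha> = real m" by (intro exI[of _ "Suc n"]) simp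
  next
    assume "\<exists>m::nat. m \<ge> 1 \<and> \<alpha> = real m"
    then obtain m where m: "m \<ge> 1" "\<alpha> = real m" by auto
    then have "1 - of_real \<alpha> = (- of_nat (m - 1) :: complex)" by (simp add: of_nat_diff)
    then show "1 - of_real \<alpha> \<in> (\<int>\<^sub>\<le>\<^sub>0 :: complex set)" by simp
  qed
  then show ?thesis by (simp add: regular_orders_def)
qed

lemma polylog_singular_term_nat:
  assumes "m \<ge> 1"
  shows "polylog_singular_term (real m) w = (-1) ^ m / fact (m - 1) * w ^ (m - 1) * (Ln w - harm (m - 1))"
  using assms by (auto simp: polylog_singular_term_def Let_def)

lemma polylog_singular_term_regular:
  assumes "of_real \<alpha> \<in> regular_orders"
  shows "polylog_singular_term \<alpha> w = Gamma (of_real (1 - \<alpha>)) * w powr of_real (\<alpha> - 1)"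
  using assms unfolding regular_orders_of_real polylog_singular_term_def by (simp only: if_False)

text \<open>
  The non-singular part of the expansion is the Taylor series at 0 of a holomorphic function. Holding
  on to this function, instead of an asymptotic statement, allows termwise integration.
\<close>

definition has_polylog_expansion :: "real \<Rightarrow> (complex \<Rightarrow> complex) \<Rightarrow> bool" where
  "has_polylog_expansion \<alpha> Y \<longleftrightarrow> Y holomorphic_on ball 0 1 \<and>
     (\<forall>w\<in>ball 0 1. Re w > 0 \<longrightarrow> exp_dirichlet (of_real \<alpha>) w = polylog_singular_term \<alpha> w + Y w) \<and>
     (\<forall>j. (deriv ^^ j) Y 0 = fact j * polylog_regular_term \<alpha> j 1)"

lemma ball_0_1_subset: "ball 0 1 \<subseteq> ball (1::complex) 2"
proof
  fix w :: complex assume "w \<in> ball 0 1"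
  then show "w \<in> ball 1 2" using norm_triangle_ineq4[of 1 w] by (simp add: dist_norm)
qed

text \<open>
  For \<open>\<alpha> \<notin> {1, 2, 3, \<dots>}\<close>, the \<open>j\<close>-th derivative of the extension at 0 is, up to sign, the value at 0
  of the extension of order \<open>\<alpha> - j\<close>, which is \<open>zeta (\<alpha> - j)\<close>.
\<close>

lemma has_polylog_expansion_regular:
  assumes \<alpha>: "of_real \<alpha> \<in> regular_orders"
  shows "has_polylog_expansion \<alpha> (regular_extension (of_real \<alpha>))"
  unfolding has_polylog_expansion_def
proof (intro conjI ballI allI impI)
  show "regular_extension (of_real \<alpha>) holomorphic_on ball 0 1"
    using regular_extension_holomorphic[OF \<alpha>] ball_0_1_subset by (rule holomorphic_on_subset)
  fix w :: complex assume w: "w \<in> ball 0 1" "Re w > 0"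
  then have "w \<in> ball 1 2" using ball_0_1_subset by auto
  from regular_extension_eq[OF \<alpha> this w(2)]
  show "exp_dirichlet (of_real \<alpha>) w = polylog_singular_term \<alpha> w + regular_extension (of_real \<alpha>) w"
    by (simp add: polylog_singular_term_regular[OF \<alpha>] regular_part_def)
next
  fix j :: nat
  have "real j \<noteq> \<alpha> - 1"
  proof
    assume "real j = \<alpha> - 1"
    then have "Suc j \<ge> 1 \<and> \<alpha> = real (Suc j)" by simp
    with \<alpha> show False unfolding regular_orders_of_real by blast
  qed
  then have "polylog_regular_term \<alpha> j 1 = (-1) ^ j / fact j * zeta (of_real \<alpha> - of_nat j)"
    by (simp add: polylog_regular_term_def)
  also have "zeta (of_real \<alpha> - of_nat j) = regular_extension (of_real \<alpha> - of_nat j) 0"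
    by (intro zeta_eq_regular_extension regular_orders_diff \<alpha>)
  finally show "(deriv ^^ j) (regular_extension (of_real \<alpha>)) 0 = fact j * polylog_regular_term \<alpha> j 1"
    using higher_deriv_regular_extension[OF \<alpha>, of 0 j] by (simp add: dist_norm)
qed

text \<open>
  The harmonic numbers are what makes the logarithmic terms obey the differentiation rule: the
  derivative of the logarithm contributes \<open>1 / m = H\<^sub>m - H\<^bsub>m-1\<^esub>\<close>.
\<close>

lemma singular_term_nat_has_derivative:
  assumes m: "m \<ge> 1" and w: "Re w > 0"
  shows "(polylog_singular_term (real (Suc m)) has_field_derivative - polylog_singular_term (real m) w) (at w)"
proof -
  have w0: "w \<notin> \<real>\<^sub>\<le>\<^sub>0" "w \<noteq> 0" using w by (auto simp: complex_nonpos_Reals_iff)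
  obtain k where k: "m = Suc k" using m by (cases m) auto
  have eq: "polylog_singular_term (real (Suc m)) = (\<lambda>w. (-1) ^ Suc m / fact m * w ^ m * (Ln w - harm m))"
    using polylog_singular_term_nat[of "Suc m"] by auto
  have "((\<lambda>w. w ^ m * (Ln w - harm m)) has_field_derivative
      of_nat m * w ^ (m - 1) * (Ln w - harm m) + w ^ m * (1 / w)) (at w)"
    using w0 by (auto intro!: derivative_eq_intros simp: divide_inverse)
  from DERIV_cmult[OF this, of "(-1) ^ Suc m / fact m"]
  have "((\<lambda>w. (-1) ^ Suc m / fact m * w ^ m * (Ln w - harm m)) has_field_derivative
      (-1) ^ Suc m / fact m * (of_nat m * w ^ (m - 1) * (Ln w - harm m) + w ^ m * (1 / w))) (at w)"
    by (simp only: mult.assoc)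
  also have "(-1) ^ Suc m / fact m * (of_nat m * w ^ (m - 1) * (Ln w - harm m) + w ^ m * (1 / w)) =
     - ((-1) ^ m / fact (m - 1) * w ^ (m - 1) * (Ln w - harm (m - 1)))"
  proof -
    have h: "harm m = harm k + (inverse (of_nat (Suc k)) :: complex)" by (simp add: k harm_Suc)
    have f: "(fact m :: complex) = of_nat (Suc k) * fact k" by (simp add: k)
    have "of_nat m * w ^ (m - 1) * (Ln w - harm m) + w ^ m * (1 / w) = of_nat (Suc k) * (w ^ k * (Ln w - harm k))"
      using w0 unfolding h by (simp add: k field_simps del: of_nat_Suc)
    then show ?thesis unfolding f by (simp add: k del: of_nat_Suc)
  qed
  finally show ?thesis unfolding eq using polylog_singular_term_nat[OF m] by simp
qed

lemma singular_term_1_has_derivative: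
  assumes w: "Re w > 0"
  shows "(polylog_singular_term 1 has_field_derivative - polylog_singular_term 0 w) (at w)"
proof -
  have w0: "w \<notin> \<real>\<^sub>\<le>\<^sub>0" "w \<noteq> 0" using w by (auto simp: complex_nonpos_Reals_iff)
  have "polylog_singular_term 1 = (\<lambda>w. - Ln w)"
    using polylog_singular_term_nat[of 1] by (auto simp: harm_def)
  moreover have "polylog_singular_term 0 w = 1 / w"
    using w0 polylog_singular_term_regular[of 0 w] Re_less_1_regular[of 0]
    by (simp add: powr_minus divide_inverse)
  moreover have "((\<lambda>w. - Ln w) has_field_derivative - (1 / w)) (at w)"
    using w0 by (auto intro!: derivative_eq_intros simp: divide_inverse)
  ultimately show ?thesis by simp
qed

text \<open>
  The zeta function has its pole at the order 1, so the constant term of this expansion has to be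
  found otherwise: from the closed form of the series.
\<close>

lemma exp_dirichlet_1_real:
  assumes x: "x > 0"
  shows "exp_dirichlet 1 (of_real x) = of_real (- ln (1 - exp (- x)))"
proof -
  define q where "q = exp (- x)"
  have q: "0 < q" "q < 1" using x by (auto simp: q_def)
  have "(\<lambda>n. - ((- (- q)) ^ n) / of_nat n) sums ln (1 + (- q))" using q by (intro ln_series') auto
  then have "(\<lambda>n. - (q ^ n) / of_nat n) sums ln (1 - q)" by simp
  then have "(\<lambda>n. - (q ^ Suc n) / of_nat (Suc n)) sums ln (1 - q)"
    by (subst sums_Suc_iff) simp
  from sums_minus[OF this]
  have "(\<lambda>n. q ^ Suc n / of_nat (Suc n)) sums (- ln (1 - q))" by simp
  then have "(\<lambda>n. of_real (q ^ Suc n / of_nat (Suc n)) :: complex) sums of_real (- ln (1 - q))"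
    by (subst sums_of_real_iff)
  moreover have "of_real (q ^ Suc n / of_nat (Suc n)) = of_nat (Suc n) powr (- 1) * exp (- of_nat (Suc n) * complex_of_real x)" for n
  proof -
    have "q ^ Suc n = exp (- real (Suc n) * x)"
      using exp_of_nat_mult[of "Suc n" "- x"] by (simp add: q_def del: power_Suc of_nat_Suc)
    then have "of_real (q ^ Suc n) = exp (- of_nat (Suc n) * complex_of_real x)"
      by (simp flip: exp_of_real)
    then show ?thesis
      by (simp add: powr_minus divide_inverse mult.commute del: power_Suc of_nat_Suc)
  qed
  ultimately show ?thesis
    unfolding exp_dirichlet_def by (simp add: sums_iff q_def)
qed

text \<open>
  The constant term of the expansion for a positive integer order: a convergent Dirichlet series from
  order 2 on, and for order 1 the limit 0 of \<open>ln x - ln (1 - exp (- x))\<close>.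
\<close>

lemma regular_part_nat_tendsto:
  "((\<lambda>x::real. exp_dirichlet (of_nat (Suc m)) (of_real x) - polylog_singular_term (real (Suc m)) (of_real x)) \<longlongrightarrow>
     polylog_regular_term (real (Suc m)) 0 1) (at_right 0)"
proof (cases m)
  case 0
  have "((\<lambda>x::real. - ln (1 - exp (- x)) + ln x) \<longlongrightarrow> 0) (at_right 0)" by real_asymp
  then have "((\<lambda>x::real. of_real (- ln (1 - exp (- x)) + ln x) :: complex) \<longlongrightarrow> of_real 0) (at_right 0)"
    by (rule tendsto_of_real)
  moreover have "\<forall>\<^sub>F x in at_right (0::real). exp_dirichlet (of_nat (Suc m)) (of_real x) - polylog_singular_term (real (Suc m)) (of_real x)
      = of_real (- ln (1 - exp (- x)) + ln x)"
    using eventually_at_right_less[of 0]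
  proof eventually_elim
    case (elim x)
    have "polylog_singular_term (real (Suc 0)) (of_real x) = - of_real (ln x)"
      using elim by (subst polylog_singular_term_nat) (simp_all add: harm_def Ln_of_real)
    then show ?case using exp_dirichlet_1_real[OF elim] 0 by simp
  qed
  ultimately show ?thesis
    using 0 by (subst tendsto_cong) (auto simp: polylog_regular_term_def)
next
  case (Suc k)
  have "((\<lambda>x::real. x ^ m * (ln x - harm m)) \<longlongrightarrow> 0) (at_right 0)"
  proof -
    have "((\<lambda>x::real. x * ln x) \<longlongrightarrow> 0) (at_right 0)" by real_asymp
    then have "((\<lambda>x::real. x ^ k * (x * ln x) - x ^ m * harm m) \<longlongrightarrow> 0 ^ k * 0 - 0 ^ m * harm m) (at_right 0)"
      by (intro tendsto_intros)
    then show ?thesis by (simp add: Suc algebra_simps)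
  qed
  then have "((\<lambda>x::real. (-1) ^ Suc m / fact m * of_real (x ^ m * (ln x - harm m)) :: complex) \<longlongrightarrow>
      (-1) ^ Suc m / fact m * of_real 0) (at_right 0)"
    by (intro tendsto_intros)
  moreover have "((\<lambda>x. exp_dirichlet (of_nat (Suc m)) (complex_of_real x)) \<longlongrightarrow> exp_dirichlet (of_nat (Suc m)) 0) (at_right 0)"
    using Suc by (intro tendsto_of_real_at_right exp_dirichlet_tendsto_0) simp
  ultimately have "((\<lambda>x::real. exp_dirichlet (of_nat (Suc m)) (of_real x) -
      (-1) ^ Suc m / fact m * of_real (x ^ m * (ln x - harm m))) \<longlongrightarrow>
      exp_dirichlet (of_nat (Suc m)) 0 - (-1) ^ Suc m / fact m * of_real 0) (at_right 0)"
    by (intro tendsto_diff)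
  moreover have "\<forall>\<^sub>F x in at_right (0::real). exp_dirichlet (of_nat (Suc m)) (of_real x) - polylog_singular_term (real (Suc m)) (of_real x)
      = exp_dirichlet (of_nat (Suc m)) (of_real x) - (-1) ^ Suc m / fact m * of_real (x ^ m * (ln x - harm m))"
    using eventually_at_right_less[of 0]
  proof eventually_elim
    case (elim x)
    have "polylog_singular_term (real (Suc m)) (of_real x) = (-1) ^ Suc m / fact m * of_real (x ^ m * (ln x - harm m))"
      using elim by (subst polylog_singular_term_nat) (simp_all add: Ln_of_real of_real_harm)
    then show ?case by simp
  qed
  moreover have "polylog_regular_term (real (Suc m)) 0 1 = exp_dirichlet (of_nat (Suc m)) 0"
    using zeta_eq_Dirichlet[of "of_nat (Suc m)"] Suc by (simp add: polylog_regular_term_def)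
  ultimately show ?thesis by (subst tendsto_cong) auto
qed

text \<open>
  Integrating the expansion of order \<open>m\<close> gives that of order \<open>m + 1\<close> up to a constant, which the
  preceding limit determines.
\<close>

lemma has_polylog_expansion_Suc:
  assumes Y: "has_polylog_expansion (real m) Y"
  shows "\<exists>Y. has_polylog_expansion (real (Suc m)) Y"
proof -
  have Yh: "Y holomorphic_on ball 0 1"
    and Yeq: "\<And>w. w \<in> ball 0 1 \<Longrightarrow> Re w > 0 \<Longrightarrow> exp_dirichlet (of_nat m) w = polylog_singular_term (real m) w + Y w"
    and Yd: "\<And>j. (deriv ^^ j) Y 0 = fact j * polylog_regular_term (real m) j 1"
    using Y by (auto simp: has_polylog_expansion_def)
  obtain P0 where P0: "\<And>x. x \<in> ball 0 1 \<Longrightarrow> (P0 has_field_derivative Y x) (at x within ball 0 1)"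
    using holomorphic_convex_primitive'[OF convex_ball open_ball Yh] by blast
  have P0: "(P0 has_field_derivative Y x) (at x)" if "x \<in> ball 0 1" for x
    using P0[OF that] at_within_open[OF that open_ball] by simp
  define U where "U = ball 0 1 \<inter> {w::complex. Re w > 0}"
  \<comment> \<open>The series minus its singular term has derivative \<open>- Y\<close>; so \<open>\<Phi>\<close> is constant, and \<open>c - P0\<close> continues that difference to 0.\<close>
  define \<Phi> where "\<Phi> = (\<lambda>w. exp_dirichlet (of_nat (Suc m)) w - polylog_singular_term (real (Suc m)) w + P0 w)"
  have "\<exists>c. \<forall>w\<in>U. \<Phi> w = c"
  proof (rule has_field_derivative_zero_constant)
    show "convex U" unfolding U_def by (intro convex_Int convex_ball convex_halfspace_Re_gt)
    fix w assume "w \<in> U"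
    then have w: "w \<in> ball 0 1" "Re w > 0" by (auto simp: U_def)
    have s: "(polylog_singular_term (real (Suc m)) has_field_derivative - polylog_singular_term (real m) w) (at w)"
      using singular_term_nat_has_derivative[of m w] singular_term_1_has_derivative[of w] w(2)
      by (cases m) auto
    have "(\<Phi> has_field_derivative - exp_dirichlet (of_nat (Suc m) - 1) w - (- polylog_singular_term (real m) w) + Y w) (at w)"
      unfolding \<Phi>_def by (intro DERIV_add DERIV_diff exp_dirichlet_has_derivative s P0 w)
    also have "- exp_dirichlet (of_nat (Suc m) - 1) w - (- polylog_singular_term (real m) w) + Y w = 0"
      using Yeq[OF w] by simp
    finally show "(\<Phi> has_field_derivative 0) (at w within U)" by (rule has_field_derivative_at_within)
  qed
  then obtain c where c: "\<And>w. w \<in> U \<Longrightarrow> \<Phi> w = c" by auto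
  define Z where "Z = (\<lambda>w. c - P0 w)"
  have Zd: "(Z has_field_derivative - Y x) (at x)" if "x \<in> ball 0 1" for x
    unfolding Z_def using P0[OF that] by (auto intro!: derivative_eq_intros)
  have Zh: "Z holomorphic_on ball 0 1" unfolding holomorphic_on_open[OF open_ball] using Zd by blast
  have Zeq: "exp_dirichlet (of_nat (Suc m)) w = polylog_singular_term (real (Suc m)) w + Z w"
    if "w \<in> ball 0 1" "Re w > 0" for w
    using c[of w] that by (simp add: U_def Z_def \<Phi>_def algebra_simps)
  have Z0: "Z 0 = polylog_regular_term (real (Suc m)) 0 1"
  proof (rule tendsto_unique)
    have "isCont Z 0" using Zd[of 0] DERIV_isCont by auto
    then have "(Z \<longlongrightarrow> Z 0) (at 0 within {w. Re w > 0})"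
      unfolding isCont_def by (rule tendsto_mono[OF at_le, rotated]) simp
    then show "((\<lambda>x::real. Z (of_real x)) \<longlongrightarrow> Z 0) (at_right 0)" by (rule tendsto_of_real_at_right)
    have "\<forall>\<^sub>F x in at_right (0::real). Z (of_real x) = exp_dirichlet (of_nat (Suc m)) (of_real x) - polylog_singular_term (real (Suc m)) (of_real x)"
      unfolding eventually_at_right_field
    proof (intro exI conjI allI impI)
      show "0 < (1::real)" by simp
      fix x :: real assume "0 < x" "x < 1"
      then show "Z (of_real x) = exp_dirichlet (of_nat (Suc m)) (of_real x) - polylog_singular_term (real (Suc m)) (of_real x)"
        by (subst Zeq) auto
    qed
    then show "((\<lambda>x::real. Z (of_real x)) \<longlongrightarrow> polylog_regular_term (real (Suc m)) 0 1) (at_right 0)"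
      using regular_part_nat_tendsto[of m] by (subst tendsto_cong) auto
  qed simp
  have Zder: "(deriv ^^ j) Z 0 = fact j * polylog_regular_term (real (Suc m)) j 1" for j
  proof (cases j)
    case 0
    then show ?thesis using Z0 by simp
  next
    case (Suc i)
    have "(deriv ^^ j) Z 0 = (deriv ^^ i) (deriv Z) 0" by (simp add: Suc funpow_Suc_right del: funpow.simps)
    also have "\<dots> = (deriv ^^ i) (\<lambda>w. - Y w) 0"
    proof (rule higher_deriv_transform_within_open)
      show "deriv Z holomorphic_on ball 0 1" by (intro holomorphic_deriv Zh) auto
      show "(\<lambda>w. - Y w) holomorphic_on ball 0 1" by (intro holomorphic_intros Yh)
    qed (use Zd in \<open>auto simp: DERIV_imp_deriv\<close>)
    also have "\<dots> = - (deriv ^^ i) Y 0"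
      by (rule higher_deriv_uminus[OF Yh]) auto
    also have "\<dots> = fact j * polylog_regular_term (real (Suc m)) j 1"
    proof -
      have "1 + of_nat i \<noteq> (0 :: complex)" using of_nat_neq_0[of i, where ?'a = complex] by simp
      then show ?thesis unfolding Yd by (auto simp: polylog_regular_term_def Suc)
    qed
    finally show ?thesis .
  qed
  show ?thesis
    using Zh Zeq Zder by (intro exI[of _ Z]) (simp add: has_polylog_expansion_def)
qed

lemma has_polylog_expansion_ex: "\<exists>Y. has_polylog_expansion \<alpha> Y"
proof (cases "of_real \<alpha> \<in> regular_orders")
  case True
  then show ?thesis using has_polylog_expansion_regular by blast
next
  case False
  then obtain m where "\<alpha> = real m" unfolding regular_orders_of_real by auto
  moreover have "\<exists>Y. has_polylog_expansion (real m) Y" for m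
  proof (induction m)
    case 0
    then show ?case using has_polylog_expansion_regular[of 0] Re_less_1_regular[of 0] by auto
  next
    case (Suc m)
    then show ?case using has_polylog_expansion_Suc by blast
  qed
  ultimately show ?thesis by simp
qed

section \<open>Truncated expansions and their remainders\<close>

lemma Taylor_remainder_bigo:
  fixes Y :: "complex \<Rightarrow> complex"
  assumes Y: "Y holomorphic_on ball 0 1"
  shows "(\<lambda>w. Y w - (\<Sum>j\<le>n. (deriv ^^ j) Y 0 / fact j * w ^ j)) \<in> O[at 0 within A](\<lambda>w. w ^ Suc n)"
proof -
  have holo: "(deriv ^^ i) Y holomorphic_on ball 0 1" for i
    by (intro holomorphic_higher_deriv Y) auto
  have sub: "cball 0 (1/2) \<subseteq> ball (0::complex) 1" by auto
  have "continuous_on (cball 0 (1/2)) ((deriv ^^ Suc n) Y)"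
    using holo sub holomorphic_on_imp_continuous_on holomorphic_on_subset by blast
  then have "bounded ((deriv ^^ Suc n) Y ` cball 0 (1/2))"
    by (intro compact_imp_bounded compact_continuous_image) auto
  then obtain B where B: "B > 0" "\<And>w. w \<in> cball 0 (1/2) \<Longrightarrow> norm ((deriv ^^ Suc n) Y w) \<le> B"
    by (auto simp: bounded_pos)
  have le: "norm (Y w - (\<Sum>j\<le>n. (deriv ^^ j) Y 0 / fact j * w ^ j)) \<le> B / fact n * norm (w ^ Suc n)"
    if w: "norm w < 1/2" for w
  proof -
    have "norm ((deriv ^^ 0) Y w - (\<Sum>j\<le>n. (deriv ^^ j) Y 0 * (w - 0) ^ j / fact j)) \<le> B * norm (w - 0) ^ Suc n / fact n"
    proof (rule complex_Taylor[of "cball 0 (1/2)"])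
      fix i x assume x: "x \<in> cball (0::complex) (1/2)"
      have "((deriv ^^ i) Y has_field_derivative deriv ((deriv ^^ i) Y) x) (at x)"
        using holo open_ball by (rule holomorphic_derivI) (use x sub in auto)
      then show "((deriv ^^ i) Y has_field_derivative (deriv ^^ Suc i) Y x) (at x within cball 0 (1/2))"
        by (auto intro: has_field_derivative_at_within)
    qed (use B w in auto)
    then show ?thesis by (simp add: norm_mult norm_power)
  qed
  have "\<forall>\<^sub>F w in at 0 within A. norm w < 1/2"
    unfolding eventually_at by (rule exI[of _ "1/2"]) (auto simp: dist_norm)
  then show ?thesis
    by (intro bigoI[of _ "B / fact n"]) (rule eventually_mono[OF _ le])
qed

lemma power_Suc_smallo: "(\<lambda>w::complex. w ^ Suc n) \<in> o[at 0 within A](\<lambda>w. w ^ n)"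
proof (rule landau_o.smallI)
  fix c :: real assume c: "c > 0"
  have "\<forall>\<^sub>F w in at (0::complex) within A. norm w < c"
    unfolding eventually_at by (rule exI[of _ c]) (use c in \<open>auto simp: dist_norm\<close>)
  then show "\<forall>\<^sub>F w in at 0 within A. norm (w ^ Suc n) \<le> c * norm (w ^ n)"
    by eventually_elim (auto simp: norm_mult norm_power intro!: mult_right_mono)
qed

lemma tendsto_Ln_times_self: "((\<lambda>w. w * Ln w) \<longlongrightarrow> 0) (at 0 within {w. Re w > 0})"
proof (rule Lim_null_comparison)
  have "((\<lambda>x::real. x * (\<bar>ln x\<bar> + pi)) \<longlongrightarrow> 0) (at_right 0)" by real_asymp
  moreover have "filterlim norm (at_right 0) (at (0::complex) within {w. Re w > 0})"
    unfolding filterlim_at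
    by (auto intro!: tendsto_eq_intros simp: eventually_at_filter)
  ultimately show "((\<lambda>w::complex. norm w * (\<bar>ln (norm w)\<bar> + pi)) \<longlongrightarrow> 0) (at 0 within {w. Re w > 0})"
    by (rule filterlim_compose)
  have "norm (w * Ln w) \<le> norm w * (\<bar>ln (norm w)\<bar> + pi)" if "w \<noteq> 0" for w
  proof -
    have "norm (Ln w) \<le> \<bar>Re (Ln w)\<bar> + \<bar>Im (Ln w)\<bar>" by (rule cmod_le)
    also have "\<dots> \<le> \<bar>ln (norm w)\<bar> + pi"
      using mpi_less_Im_Ln[OF that] Im_Ln_le_pi[OF that] that by simp
    finally show ?thesis unfolding norm_mult by (intro mult_left_mono) auto
  qed
  then show "\<forall>\<^sub>F w in at 0 within {w. Re w > 0}. norm (w * Ln w) \<le> norm w * (\<bar>ln (norm w)\<bar> + pi)"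
    by (auto simp: eventually_at_filter)
qed

text \<open>
  A singular term that is cut off by the truncation is negligible, also with its logarithm.
\<close>

lemma polylog_singular_term_smallo:
  assumes \<alpha>: "\<alpha> - 1 > real N"
  shows "polylog_singular_term \<alpha> \<in> o[at 0 within {w. Re w > 0}](\<lambda>w. w ^ N)"
proof (rule smalloI_tendsto)
  have nz: "\<forall>\<^sub>F w in at 0 within {w. Re w > 0}. w \<noteq> (0::complex)"
    by (simp add: eventually_at_filter)
  then show "\<forall>\<^sub>F w in at 0 within {w. Re w > 0}. (w::complex) ^ N \<noteq> 0"
    by eventually_elim simp
  show "((\<lambda>w. polylog_singular_term \<alpha> w / w ^ N) \<longlongrightarrow> 0) (at 0 within {w. Re w > 0})"
  proof (cases "of_real \<alpha> \<in> regular_orders")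
    case True
    have "((\<lambda>w. Gamma (of_real (1 - \<alpha>)) * w powr (of_real (\<alpha> - 1 - real N))) \<longlongrightarrow> Gamma (of_real (1 - \<alpha>)) * 0)
            (at 0 within {w. Re w > 0})"
      using \<alpha> by (intro tendsto_intros tendsto_powr_complex_0[where b = "of_real (\<alpha> - 1 - real N)"]) auto
    moreover have "\<forall>\<^sub>F w in at 0 within {w. Re w > 0}. polylog_singular_term \<alpha> w / w ^ N =
        Gamma (of_real (1 - \<alpha>)) * w powr (of_real (\<alpha> - 1 - real N))"
      using nz
    proof eventually_elim
      case (elim w)
      then have "w powr (of_real (\<alpha> - 1 - real N)) = w powr of_real (\<alpha> - 1) / w ^ N"
        using powr_diff[of w "of_real (\<alpha> - 1)" "of_nat N"] by (simp add: powr_nat)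
      then show ?case by (simp add: polylog_singular_term_regular[OF True])
    qed
    ultimately show ?thesis by (subst tendsto_cong) auto
  next
    case False
    then obtain m where m: "m \<ge> 1" "\<alpha> = real m" unfolding regular_orders_of_real by auto
    with \<alpha> have "m - 1 > N" by linarith
    then obtain k where k: "m - 1 = N + Suc k" by (auto dest: less_imp_Suc_add)
    have "((\<lambda>w::complex. (-1) ^ m / fact (m - 1) * (w ^ k * (w * Ln w) - w ^ Suc k * harm (m - 1))) \<longlongrightarrow>
       (-1) ^ m / fact (m - 1) * (0 ^ k * 0 - 0 ^ Suc k * harm (m - 1))) (at 0 within {w. Re w > 0})"
      by (intro tendsto_intros tendsto_Ln_times_self)
    moreover have "\<forall>\<^sub>F w in at 0 within {w. Re w > 0}. polylog_singular_term \<alpha> w / w ^ N =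
        (-1) ^ m / fact (m - 1) * (w ^ k * (w * Ln w) - w ^ Suc k * harm (m - 1))"
      using nz
    proof eventually_elim
      case (elim w)
      have "polylog_singular_term \<alpha> w = w ^ N * ((-1) ^ m / fact (m - 1) * (w ^ k * (w * Ln w) - w ^ Suc k * harm (m - 1)))"
        unfolding m(2) polylog_singular_term_nat[OF m(1)] k by (simp add: power_add algebra_simps)
      then show ?case using elim by simp
    qed
    ultimately show ?thesis by (subst tendsto_cong) auto
  qed
qed

lemma polylog_expansion_smallo:
  "(\<lambda>w. exp_dirichlet (of_real \<alpha>) w - polylog_trunc \<alpha> N w) \<in> o[at 0 within {w. Re w > 0}](\<lambda>w. w ^ N)"
proof -
  obtain Y where Y: "Y holomorphic_on ball 0 1"
    "\<And>w. w \<in> ball 0 1 \<Longrightarrow> Re w > 0 \<Longrightarrow> exp_dirichlet (of_real \<alpha>) w = polylog_singular_term \<alpha> w + Y w"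
    "\<And>j. (deriv ^^ j) Y 0 = fact j * polylog_regular_term \<alpha> j 1"
    using has_polylog_expansion_ex[of \<alpha>] by (auto simp: has_polylog_expansion_def)
  define R where "R = (\<lambda>w. Y w - (\<Sum>j\<le>N. (deriv ^^ j) Y 0 / fact j * w ^ j))"
  define S where "S = (\<lambda>w. if \<alpha> - 1 > real N then polylog_singular_term \<alpha> w else 0)"
  have "R \<in> O[at 0 within {w. Re w > 0}](\<lambda>w. w ^ Suc N)"
    unfolding R_def by (rule Taylor_remainder_bigo[OF Y(1)])
  then have "R \<in> o[at 0 within {w. Re w > 0}](\<lambda>w. w ^ N)"
    by (rule landau_o.big_small_trans[OF _ power_Suc_smallo])
  moreover have "S \<in> o[at 0 within {w. Re w > 0}](\<lambda>w. w ^ N)"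
    unfolding S_def using polylog_singular_term_smallo[of N \<alpha>] by (cases "\<alpha> - 1 > real N") simp_all
  ultimately have "(\<lambda>w. R w + S w) \<in> o[at 0 within {w. Re w > 0}](\<lambda>w. w ^ N)"
    by (rule sum_in_smallo)
  moreover have "\<forall>\<^sub>F w in at 0 within {w. Re w > 0}. R w + S w = exp_dirichlet (of_real \<alpha>) w - polylog_trunc \<alpha> N w"
    unfolding eventually_at
  proof (intro exI[of _ 1] conjI ballI impI)
    fix w :: complex assume "w \<in> {w. Re w > 0}" "w \<noteq> 0 \<and> dist w 0 < 1"
    then have w: "w \<in> ball 0 1" "Re w > 0" by auto
    have "(deriv ^^ j) Y 0 / fact j * w ^ j = polylog_regular_term \<alpha> j w" for j
      by (simp add: Y(3) polylog_regular_term_def)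
    then show "R w + S w = exp_dirichlet (of_real \<alpha>) w - polylog_trunc \<alpha> N w"
      by (simp add: R_def S_def polylog_trunc_def Y(2)[OF w])
  qed simp
  ultimately show ?thesis by (simp cong: landau_o.small.in_cong)
qed

text \<open>
  All derivatives of \<open>exp\<close> are bounded by 1 on the left half-plane, so the Taylor bound is free of
  the usual exponential factor.
\<close>

lemma norm_exp_minus_Taylor_le:
  fixes z :: complex
  assumes "Re z \<le> 0"
  shows "norm (exp z - (\<Sum>j\<le>n. z ^ j / fact j)) \<le> norm z ^ Suc n"
proof -
  have "norm (exp z - (\<Sum>j\<le>n. exp 0 * (z - 0) ^ j / fact j)) \<le> 1 * norm (z - 0) ^ Suc n / fact n"
    by (rule complex_Taylor[of "{z. Re z \<le> 0}" n "\<lambda>_. exp"])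
       (use assms in \<open>auto intro: convex_halfspace_Re_le DERIV_exp has_field_derivative_at_within\<close>)
  also have "\<dots> \<le> norm z ^ Suc n / 1" by (intro frac_le) auto
  finally show ?thesis by simp
qed

text \<open>
  For a large order the Taylor polynomials of all the factors \<open>exp (- n w)\<close> can be summed, because
  the Dirichlet series for \<open>zeta (\<alpha> - j)\<close> converge for \<open>j \<le> N\<close>. The constant does not depend on the
  order \<open>\<alpha>\<close>, which is what makes the remainders summable over infinitely many orders.
\<close>

lemma polylog_remainder_large_order:
  assumes \<alpha>: "\<alpha> \<ge> real N + 3" and w: "Re w > 0"
  shows "norm (exp_dirichlet (of_real \<alpha>) w - polylog_trunc \<alpha> N w) \<le> (\<Sum>n. real (Suc n) powr (- 2)) * norm w ^ Suc N"
proof -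
  define u where "u = (\<lambda>n. (of_nat (Suc n) :: complex) powr (- of_real \<alpha>))"
  have reg: "(\<lambda>n. u n * ((- of_nat (Suc n) * w) ^ j / fact j)) sums polylog_regular_term \<alpha> j w" if j: "j \<le> N" for j
  proof -
    have Re: "Re (of_real (\<alpha> - real j)) > 1" using \<alpha> j by simp
    have "summable (\<lambda>n. of_nat (Suc n) powr (- of_real (\<alpha> - real j)) * exp (- of_nat (Suc n) * 0) :: complex)"
    proof (rule summable_norm_cancel)
      show "summable (\<lambda>n. norm (of_nat (Suc n) powr (- of_real (\<alpha> - real j)) * exp (- of_nat (Suc n) * 0) :: complex))"
        unfolding norm_exp_dirichlet_term using summable_Dirichlet[OF Re] by simp
    qed
    then have "(\<lambda>n. of_nat (Suc n) powr (- of_real (\<alpha> - real j)) * exp (- of_nat (Suc n) * 0)) sums zeta (of_real (\<alpha> - real j))"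
      unfolding zeta_eq_Dirichlet[OF Re] exp_dirichlet_def by (rule summable_sums)
    then have "(\<lambda>n. (-1) ^ j / fact j * w ^ j * (of_nat (Suc n) powr (- of_real (\<alpha> - real j)) * exp (- of_nat (Suc n) * 0))) sums
       ((-1) ^ j / fact j * w ^ j * zeta (of_real (\<alpha> - real j)))"
      by (rule sums_mult)
    moreover have "(-1) ^ j / fact j * w ^ j * (of_nat (Suc n) powr (- of_real (\<alpha> - real j)) * exp (- of_nat (Suc n) * 0)) =
      u n * ((- of_nat (Suc n) * w) ^ j / fact j)" for n
    proof -
      have nz: "(of_nat (Suc n) :: complex) \<noteq> 0" by (simp del: of_nat_Suc)
      have "(of_nat (Suc n) :: complex) powr (- of_real (\<alpha> - real j)) = of_nat (Suc n) powr (- of_real \<alpha> + of_nat j)"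
        by simp
      also have "\<dots> = u n * of_nat (Suc n) ^ j"
        unfolding powr_add u_def using nz by (simp add: powr_nat del: of_nat_Suc)
      finally have p: "(of_nat (Suc n) :: complex) powr (- of_real (\<alpha> - real j)) = u n * of_nat (Suc n) ^ j" .
      have "(- of_nat (Suc n) * w) ^ j = (-1) ^ j * of_nat (Suc n) ^ j * w ^ j"
        by (simp only: power_mult_distrib[symmetric] mult_minus1)
      then show ?thesis unfolding p by (simp add: mult_ac del: of_nat_Suc)
    qed
    moreover have "real j \<noteq> \<alpha> - 1" using \<alpha> j by simp
    ultimately show ?thesis by (simp add: polylog_regular_term_def mult_ac)
  qed
  have trunc: "polylog_trunc \<alpha> N w = (\<Sum>j\<le>N. polylog_regular_term \<alpha> j w)"
    using \<alpha> by (simp add: polylog_trunc_def)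
  have "(\<lambda>n. u n * exp (- of_nat (Suc n) * w) - (\<Sum>j\<le>N. u n * ((- of_nat (Suc n) * w) ^ j / fact j))) sums
     (exp_dirichlet (of_real \<alpha>) w - polylog_trunc \<alpha> N w)"
    unfolding trunc u_def using w
    by (intro sums_diff sums_sum exp_dirichlet_sums) (use reg in \<open>auto simp: u_def\<close>)
  then have "(\<lambda>n. u n * (exp (- of_nat (Suc n) * w) - (\<Sum>j\<le>N. (- of_nat (Suc n) * w) ^ j / fact j))) sums
     (exp_dirichlet (of_real \<alpha>) w - polylog_trunc \<alpha> N w)"
    by (simp only: right_diff_distrib sum_distrib_left)
  moreover have "(\<lambda>n. real (Suc n) powr (- 2) * norm w ^ Suc N) sums ((\<Sum>n. real (Suc n) powr (- 2)) * norm w ^ Suc N)"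
    using summable_Dirichlet[of 2] by (intro sums_mult2 summable_sums) simp
  ultimately show ?thesis
  proof (rule norm_sums_le)
    fix n
    have "norm (u n * (exp (- of_nat (Suc n) * w) - (\<Sum>j\<le>N. (- of_nat (Suc n) * w) ^ j / fact j))) \<le>
        real (Suc n) powr (- \<alpha>) * norm (- of_nat (Suc n) * w) ^ Suc N"
    proof -
      have "norm (u n) = real (Suc n) powr (- \<alpha>)"
        using norm_exp_dirichlet_term[of n "of_real \<alpha>" 0] by (simp add: u_def)
      moreover have "Re (- of_nat (Suc n) * w) \<le> 0" using w by (simp add: mult_nonpos_nonneg)
      ultimately show ?thesis unfolding norm_mult[of "u n"]
        by (metis norm_exp_minus_Taylor_le mult_left_mono norm_ge_zero)
    qed
    also have "\<dots> = real (Suc n) powr (- \<alpha> + real (Suc N)) * norm w ^ Suc N"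
    proof -
      have "norm (- of_nat (Suc n) * w) = real (Suc n) * norm w"
        by (simp add: norm_mult del: of_nat_Suc)
      then show ?thesis
        by (simp only: powr_add powr_realpow[OF of_nat_0_less_iff[THEN iffD2, OF zero_less_Suc]] power_mult_distrib mult.assoc)
    qed
    also have "\<dots> \<le> real (Suc n) powr (- 2) * norm w ^ Suc N"
      using \<alpha> by (intro mult_right_mono powr_mono) auto
    finally show "norm (u n * (exp (- of_nat (Suc n) * w) - (\<Sum>j\<le>N. (- of_nat (Suc n) * w) ^ j / fact j))) \<le>
        real (Suc n) powr (- 2) * norm w ^ Suc N" .
  qed
qed

section \<open>Termwise expansion of the series\<close>

lemma exp_Taylor_tail_le:
  fixes y c :: real
  assumes "\<bar>y\<bar> \<le> \<bar>c\<bar>"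
  shows "\<bar>exp y - (\<Sum>k<K. y ^ k / fact k)\<bar> \<le> exp \<bar>c\<bar> - (\<Sum>k<K. \<bar>c\<bar> ^ k / fact k)"
proof -
  have e: "(\<lambda>k. x ^ k / fact k) sums exp x" for x :: real
    using exp_converges[of x] by (simp add: divide_inverse mult.commute)
  have "norm (exp y - (\<Sum>k<K. y ^ k / fact k)) \<le> exp \<bar>c\<bar> - (\<Sum>k<K. \<bar>c\<bar> ^ k / fact k)"
    by (rule norm_sums_le[OF sums_split_initial_segment[OF e] sums_split_initial_segment[OF e]])
       (use assms in \<open>auto simp: norm_divide power_abs intro!: divide_right_mono power_mono\<close>)
  then show ?thesis by simp
qed

text \<open>
  Expand \<open>exp (c n\<^bsup>\<theta>\<^esup>)\<close>. As \<open>\<theta> < 0\<close>, the arguments are at most \<open>\<bar>c\<bar>\<close> in absolute value, so the tails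
  of these exponential series are small uniformly in \<open>n\<close>, and the geometric series in \<open>z\<close> does
  the rest.
\<close>

lemma E_sums_polylog:
  fixes c \<theta> :: real and z :: complex
  assumes \<theta>: "\<theta> < 0" and z: "norm z < 1"
  shows "(\<lambda>k. of_real (c ^ k / fact k) * polylog (- real k * \<theta>) (- z)) sums E z c \<theta>"
proof -
  define T where "T = (\<lambda>K. exp \<bar>c\<bar> - (\<Sum>k<K. \<bar>c\<bar> ^ k / fact k))"
  define y where "y = (\<lambda>n. c * real (Suc n) powr \<theta>)"
  have y: "\<bar>y n\<bar> \<le> \<bar>c\<bar>" for n
  proof -
    have "real (Suc n) powr \<theta> \<le> real (Suc n) powr 0" using \<theta> by (intro powr_mono) auto
    then show ?thesis by (auto simp: y_def abs_mult intro!: mult_left_le)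
  qed
  have yk: "of_real (y n ^ k / fact k) = of_real (c ^ k / fact k) * (1 / (of_real (real (Suc n) powr (- real k * \<theta>)) :: complex))" for n k
  proof -
    have "(real (Suc n) powr \<theta>) ^ k = inverse (real (Suc n) powr (- real k * \<theta>))"
      by (simp add: powr_power powr_minus mult.commute)
    then have "y n ^ k / fact k = c ^ k / fact k * (1 / real (Suc n) powr (- real k * \<theta>))"
      by (simp add: y_def power_mult_distrib divide_inverse del: of_nat_Suc)
    then show ?thesis by (simp only: of_real_mult of_real_divide of_real_1)
  qed
  have geo: "summable (\<lambda>n. norm ((- z) ^ Suc n))"
    using z summable_geometric[of "norm z"] by (simp add: norm_power norm_mult summable_mult)
  have pl: "(\<lambda>n. of_real (y n ^ k / fact k) * (- z) ^ Suc n) sums (of_real (c ^ k / fact k) * polylog (- real k * \<theta>) (- z))" for k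
  proof -
    have "summable (\<lambda>n. (- z) ^ Suc n / of_real (real (Suc n) powr (- real k * \<theta>)))"
    proof (rule summable_comparison_test'[OF geo])
      fix n
      have "real (Suc n) powr (- real k * \<theta>) \<ge> real (Suc n) powr 0"
        using \<theta> by (intro powr_mono) (auto simp: mult_nonneg_nonpos)
      then have "1 \<le> real (Suc n) powr (- real k * \<theta>)" by simp
      then show "norm ((- z) ^ Suc n / of_real (real (Suc n) powr (- real k * \<theta>))) \<le> norm ((- z) ^ Suc n)"
        using divide_left_mono[of 1 "real (Suc n) powr (- real k * \<theta>)" "norm ((- z) ^ Suc n)"]
        unfolding norm_divide norm_of_real by (simp del: power_Suc of_nat_Suc)
    qed
    then have "(\<lambda>n. of_real (c ^ k / fact k) * ((- z) ^ Suc n / of_real (real (Suc n) powr (- real k * \<theta>)))) sums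
       (of_real (c ^ k / fact k) * polylog (- real k * \<theta>) (- z))"
      unfolding polylog_def by (intro sums_mult summable_sums)
    then show ?thesis unfolding yk by (simp only: mult_ac times_divide_eq_right mult_1_right mult_1_left)
  qed
  have Es: "(\<lambda>n. of_real (exp (y n)) * (- z) ^ Suc n) sums E z c \<theta>"
  proof -
    have "summable (\<lambda>n. of_real (exp (y n)) * (- z) ^ Suc n)"
    proof (rule summable_comparison_test'[OF summable_mult[OF geo, of "exp \<bar>c\<bar>"]])
      fix n
      have "exp (y n) \<le> exp \<bar>c\<bar>" using y[of n] by simp
      then show "norm (of_real (exp (y n)) * (- z) ^ Suc n) \<le> exp \<bar>c\<bar> * norm ((- z) ^ Suc n)"
        unfolding norm_mult[of "of_real (exp (y n))"] by (intro mult_right_mono) auto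
    qed
    then show ?thesis unfolding E_def y_def by (rule summable_sums)
  qed
  have bound: "norm (E z c \<theta> - (\<Sum>k<K. of_real (c ^ k / fact k) * polylog (- real k * \<theta>) (- z))) \<le>
     T K * (\<Sum>n. norm ((- z) ^ Suc n))" for K
  proof (rule norm_sums_le)
    show "(\<lambda>n. of_real (exp (y n)) * (- z) ^ Suc n - (\<Sum>k<K. of_real (y n ^ k / fact k) * (- z) ^ Suc n)) sums
      (E z c \<theta> - (\<Sum>k<K. of_real (c ^ k / fact k) * polylog (- real k * \<theta>) (- z)))"
      by (intro sums_diff sums_sum Es pl)
    show "(\<lambda>n. T K * norm ((- z) ^ Suc n)) sums (T K * (\<Sum>n. norm ((- z) ^ Suc n)))"
      by (intro sums_mult summable_sums geo)
    fix n
    have "of_real (exp (y n)) * (- z) ^ Suc n - (\<Sum>k<K. of_real (y n ^ k / fact k) * (- z) ^ Suc n) =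
       of_real (exp (y n) - (\<Sum>k<K. y n ^ k / fact k)) * (- z) ^ Suc n"
      by (simp only: left_diff_distrib of_real_diff of_real_sum sum_distrib_right)
    then have "norm (of_real (exp (y n)) * (- z) ^ Suc n - (\<Sum>k<K. of_real (y n ^ k / fact k) * (- z) ^ Suc n)) =
       \<bar>exp (y n) - (\<Sum>k<K. y n ^ k / fact k)\<bar> * norm ((- z) ^ Suc n)"
      by (simp only: norm_mult norm_of_real)
    also have "\<dots> \<le> T K * norm ((- z) ^ Suc n)"
      unfolding T_def by (intro mult_right_mono exp_Taylor_tail_le y) auto
    finally show "norm (of_real (exp (y n)) * (- z) ^ Suc n - (\<Sum>k<K. of_real (y n ^ k / fact k) * (- z) ^ Suc n)) \<le> T K * norm ((- z) ^ Suc n)" .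
  qed
  have "T \<longlonglongrightarrow> exp \<bar>c\<bar> - exp \<bar>c\<bar>"
    unfolding T_def using exp_converges[of "\<bar>c\<bar>"]
    by (intro tendsto_diff tendsto_const) (simp add: sums_def divide_inverse mult.commute)
  then have "(\<lambda>K. T K * (\<Sum>n. norm ((- z) ^ Suc n))) \<longlonglongrightarrow> 0"
    by (intro tendsto_mult_left_zero) simp
  then have "(\<lambda>K. E z c \<theta> - (\<Sum>k<K. of_real (c ^ k / fact k) * polylog (- real k * \<theta>) (- z))) \<longlonglongrightarrow> 0"
    by (rule Lim_null_comparison[rotated]) (use bound in auto)
  from tendsto_diff[OF tendsto_const this, of "E z c \<theta>"]
  show ?thesis by (simp add: sums_def)
qed

text \<open>
  Finitely many remainders have the right size by the expansions of the polylogarithms. The others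
  have large order, where the uniform bound applies, and the weights \<open>\<bar>c\<bar>\<^bsup>k\<^esup> / k!\<close> are summable.
\<close>

lemma series_polylog_remainder_smallo:
  fixes c \<beta> :: real and N :: nat
  assumes \<beta>: "\<beta> > 0"
  defines "D \<equiv> \<lambda>k w. of_real (c ^ k / fact k) * (exp_dirichlet (of_real (real k * \<beta>)) w - polylog_trunc (real k * \<beta>) N w) :: complex"
  shows "Re w > 0 \<Longrightarrow> summable (\<lambda>k. D k w)"
    and "(\<lambda>w. \<Sum>k. D k w) \<in> o[at 0 within {w. Re w > 0}](\<lambda>w. w ^ N)"
proof -
  define M where "M = (\<Sum>n. real (Suc n) powr (- 2))"
  have M: "M \<ge> 0"
    unfolding M_def using summable_Dirichlet[of 2] by (intro suminf_nonneg) auto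
  \<comment> \<open>From index \<open>K\<close> on, the bound for large orders applies.\<close>
  obtain K :: nat where K: "real K * \<beta> \<ge> real N + 3"
    using reals_Archimedean3[OF \<beta>] less_imp_le by blast
  have e: "(\<lambda>k. \<bar>c\<bar> ^ k / fact k) sums exp \<bar>c\<bar>"
    using exp_converges[of "\<bar>c\<bar>"] by (simp add: divide_inverse mult.commute)
  have tail: "norm (D (k + K) w) \<le> \<bar>c\<bar> ^ (k + K) / fact (k + K) * (M * norm w ^ Suc N)" if "Re w > 0" for k w
  proof -
    have "real K * \<beta> \<le> real (k + K) * \<beta>" using \<beta> by (intro mult_right_mono) auto
    then have "norm (exp_dirichlet (of_real (real (k + K) * \<beta>)) w - polylog_trunc (real (k + K) * \<beta>) N w) \<le> M * norm w ^ Suc N"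
      unfolding M_def using K that by (intro polylog_remainder_large_order) auto
    then have "\<bar>c ^ (k + K) / fact (k + K)\<bar> * norm (exp_dirichlet (of_real (real (k + K) * \<beta>)) w - polylog_trunc (real (k + K) * \<beta>) N w)
       \<le> \<bar>c ^ (k + K) / fact (k + K)\<bar> * (M * norm w ^ Suc N)"
      by (intro mult_left_mono) auto
    then show ?thesis unfolding D_def norm_mult norm_of_real by (simp add: power_abs)
  qed
  have e': "(\<lambda>k. \<bar>c\<bar> ^ (k + K) / fact (k + K) * (M * norm w ^ Suc N)) sums
      ((exp \<bar>c\<bar> - (\<Sum>k<K. \<bar>c\<bar> ^ k / fact k)) * (M * norm w ^ Suc N))" for w :: complex
    by (intro sums_mult2 sums_split_initial_segment e)
  have summ_tail: "summable (\<lambda>k. D (k + K) w)" if "Re w > 0" for w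
    using sums_summable[OF e'] tail[OF that] by (rule summable_comparison_test')
  show summ: "summable (\<lambda>k. D k w)" if "Re w > 0" for w
    using summ_tail[OF that] by (subst (asm) summable_iff_shift)
  have "(\<lambda>w. \<Sum>k. D (k + K) w) \<in> O[at 0 within {w. Re w > 0}](\<lambda>w. w ^ Suc N)"
  proof (rule bigoI)
    show "\<forall>\<^sub>F w in at 0 within {w. Re w > 0}. norm (\<Sum>k. D (k + K) w) \<le> exp \<bar>c\<bar> * M * norm (w ^ Suc N)"
      unfolding eventually_at_filter
    proof (intro always_eventually allI impI)
      fix w :: complex assume "w \<in> {w. Re w > 0}"
      then have w: "Re w > 0" by simp
      have "norm (\<Sum>k. D (k + K) w) \<le> (exp \<bar>c\<bar> - (\<Sum>k<K. \<bar>c\<bar> ^ k / fact k)) * (M * norm w ^ Suc N)"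
        by (rule norm_sums_le[OF summable_sums[OF summ_tail[OF w]] e' tail[OF w]])
      also have "\<dots> \<le> exp \<bar>c\<bar> * (M * norm w ^ Suc N)"
        using M by (intro mult_right_mono mult_nonneg_nonneg) (auto intro!: sum_nonneg)
      finally show "norm (\<Sum>k. D (k + K) w) \<le> exp \<bar>c\<bar> * M * norm (w ^ Suc N)"
        by (simp add: norm_power norm_mult mult_ac)
    qed
  qed
  then have "(\<lambda>w. \<Sum>k. D (k + K) w) \<in> o[at 0 within {w. Re w > 0}](\<lambda>w. w ^ N)"
    by (rule landau_o.big_small_trans[OF _ power_Suc_smallo])
  moreover have "D k \<in> o[at 0 within {w. Re w > 0}](\<lambda>w. w ^ N)" for k
    unfolding D_def using polylog_expansion_smallo[of "real k * \<beta>" N] by simp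
  then have "(\<lambda>w. \<Sum>k<K. D k w) \<in> o[at 0 within {w. Re w > 0}](\<lambda>w. w ^ N)"
    by (intro big_sum_in_smallo)
  ultimately have "(\<lambda>w. (\<Sum>k. D (k + K) w) + (\<Sum>k<K. D k w)) \<in> o[at 0 within {w. Re w > 0}](\<lambda>w. w ^ N)"
    by (rule sum_in_smallo)
  moreover have "\<forall>\<^sub>F w in at 0 within {w. Re w > 0}. (\<Sum>k. D (k + K) w) + (\<Sum>k<K. D k w) = (\<Sum>k. D k w)"
    unfolding eventually_at_filter
    using suminf_split_initial_segment[OF summ, of _ K] by (intro always_eventually) auto
  ultimately show "(\<lambda>w. \<Sum>k. D k w) \<in> o[at 0 within {w. Re w > 0}](\<lambda>w. w ^ N)"
    by (simp cong: landau_o.small.in_cong)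
qed

lemma minus_Ln_minus:
  assumes "z \<noteq> 0" "norm z < 1"
  shows "Re (- Ln (- z)) > 0" "exp (- (- Ln (- z))) = - z"
  using assms by (simp_all add: ln_less_zero)

lemma filterlim_minus_Ln_minus:
  "filterlim (\<lambda>z. - Ln (- z)) (at 0 within {w. Re w > 0}) (at (- 1) within ball 0 1)"
  unfolding filterlim_at
proof (intro conjI)
  have "isCont (\<lambda>z. - Ln (- z)) (- 1)"
    by (intro continuous_intros) (auto simp: complex_nonpos_Reals_iff)
  then have "((\<lambda>z. - Ln (- z)) \<longlongrightarrow> - Ln (- (- 1))) (at (- 1) within ball 0 1)"
    unfolding isCont_def by (rule tendsto_mono[OF at_le, rotated]) simp
  then show "((\<lambda>z. - Ln (- z)) \<longlongrightarrow> 0) (at (- 1) within ball 0 1)" by simp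
  show "\<forall>\<^sub>F z in at (- 1) within ball 0 1. - Ln (- z) \<in> {w. Re w > 0} \<and> - Ln (- z) \<noteq> 0"
    unfolding eventually_at
  proof (intro exI[of _ 1] conjI ballI impI)
    fix z :: complex assume z: "z \<in> ball 0 1" "z \<noteq> - 1 \<and> dist z (- 1) < 1"
    then have "z \<noteq> 0" "norm z < 1" by auto
    from minus_Ln_minus(1)[OF this]
    show "- Ln (- z) \<in> {w. Re w > 0}" "- Ln (- z) \<noteq> 0" by auto
  qed simp
qed

theorem proposition3:
  fixes c \<theta> :: real
  assumes "\<theta> < 0"
  shows "(\<forall>z::complex. norm z < 1 \<longrightarrow>
            (\<lambda>k. of_real (c ^ k / fact k) * polylog (- real k * \<theta>) (- z)) sums E z c \<theta>) \<and>
         (\<forall>N::nat.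
            (\<forall>z::complex. z \<noteq> 0 \<and> norm z < 1 \<longrightarrow>
               summable (\<lambda>k. of_real (c ^ k / fact k) *
                              polylog_trunc (- real k * \<theta>) N (- Ln (- z)))) \<and>
            (\<lambda>z::complex. E z c \<theta> -
               (\<Sum>k. of_real (c ^ k / fact k) * polylog_trunc (- real k * \<theta>) N (- Ln (- z))))
              \<in> o[at (-1) within ball 0 1](\<lambda>z. (- Ln (- z)) ^ N))"
proof (intro conjI allI impI)
  show "(\<lambda>k. of_real (c ^ k / fact k) * polylog (- real k * \<theta>) (- z)) sums E z c \<theta>"
    if "norm z < 1" for z :: complex
    using assms that by (rule E_sums_polylog)
next
  fix N :: nat
  define a where "a = (\<lambda>k. of_real (c ^ k / fact k) :: complex)"
  define W where "W = (\<lambda>z::complex. - Ln (- z))"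
  define D where "D = (\<lambda>k w. a k * (exp_dirichlet (of_real (real k * (- \<theta>))) w - polylog_trunc (real k * (- \<theta>)) N w))"
  have D_summable: "summable (\<lambda>k. D k w)" if "Re w > 0" for w
    unfolding D_def a_def using assms that by (intro series_polylog_remainder_smallo) auto
  have D_smallo: "(\<lambda>w. \<Sum>k. D k w) \<in> o[at 0 within {w. Re w > 0}](\<lambda>w. w ^ N)"
    unfolding D_def a_def using assms by (intro series_polylog_remainder_smallo) auto
  have trunc_sums: "(\<lambda>k. a k * polylog_trunc (- real k * \<theta>) N (W z)) sums (E z c \<theta> - (\<Sum>k. D k (W z)))"
    if z: "z \<noteq> 0" "norm z < 1" for z
  proof -
    have "(\<lambda>k. a k * polylog (- real k * \<theta>) (- z) - D k (W z)) sums (E z c \<theta> - (\<Sum>k. D k (W z)))"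
      unfolding a_def W_def using assms z minus_Ln_minus(1)[OF z]
      by (intro sums_diff E_sums_polylog summable_sums D_summable)
    moreover have "polylog (- real k * \<theta>) (- z) = exp_dirichlet (of_real (real k * (- \<theta>))) (W z)" for k
      using polylog_eq_exp_dirichlet[of "- real k * \<theta>" "W z"] minus_Ln_minus(2)[OF z] by (simp add: W_def)
    ultimately show ?thesis by (simp add: D_def right_diff_distrib)
  qed
  show "summable (\<lambda>k. of_real (c ^ k / fact k) * polylog_trunc (- real k * \<theta>) N (- Ln (- z)))"
    if "z \<noteq> 0 \<and> norm z < 1" for z :: complex
    using sums_summable[OF trunc_sums[of z]] that unfolding a_def W_def by blast
  have "(\<lambda>z. \<Sum>k. D k (W z)) \<in> o[at (- 1) within ball 0 1](\<lambda>z. W z ^ N)"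
    using D_smallo filterlim_minus_Ln_minus unfolding W_def by (rule landau_o.small.compose)
  moreover have "\<forall>\<^sub>F z in at (- 1) within ball 0 1. (\<Sum>k. D k (W z)) =
      E z c \<theta> - (\<Sum>k. a k * polylog_trunc (- real k * \<theta>) N (W z))"
    unfolding eventually_at
  proof (intro exI[of _ 1] conjI ballI impI)
    fix z :: complex assume "z \<in> ball 0 1" "z \<noteq> - 1 \<and> dist z (- 1) < 1"
    then have "z \<noteq> 0" "norm z < 1" by auto
    from sums_unique[OF trunc_sums[OF this]]
    show "(\<Sum>k. D k (W z)) = E z c \<theta> - (\<Sum>k. a k * polylog_trunc (- real k * \<theta>) N (W z))"
      by (simp add: algebra_simps)
  qed simp
  ultimately have "(\<lambda>z. E z c \<theta> - (\<Sum>k. a k * polylog_trunc (- real k * \<theta>) N (W z)))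
      \<in> o[at (- 1) within ball 0 1](\<lambda>z. W z ^ N)"
    by (rule landau_o.small.in_cong[THEN iffD1, rotated])
  then show "(\<lambda>z::complex. E z c \<theta> -
               (\<Sum>k. of_real (c ^ k / fact k) * polylog_trunc (- real k * \<theta>) N (- Ln (- z))))
              \<in> o[at (-1) within ball 0 1](\<lambda>z. (- Ln (- z)) ^ N)"
    unfolding a_def W_def .
qed

end
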